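(* There exist constants $C,\hat C,C'$ and an integer $n_0$ such that for every $n\ge n_0$ the torus passage time $f^\tau=f^\tau_n$ satisfies $$\operatorname{var}(f^\tau)\leq C\,\frac{\sum_{M\subseteq W,\,|M|=2}\|\partial_Mf^\tau\|_2^2}{(\log n)^2}+C'\leq\hat C\,\frac{\mathbb E[N_2]}{(\log n)^2}+C'.$$
   Context: Fix $d\ge2$, real numbers $0<a<b$ and $p\in(0,1)$ (the constants do not depend on $n$). Torus model. The graph has vertex set $\mathbb Z_n^d$, where $\mathbb Z_n=\mathbb Z/n\mathbb Z$. Its edges are indexed by pairs $(x,k)$ with $x\in\mathbb Z_n^d$ and $1\le k\le d$; the edge $(x,k)$ joins $x$ and $x+e_k$, where $e_k$ is the $k$-th unit vector (so for $n\ge3$ two vertices are adjacent iff they differ by $\pm1$ mod $n$ in exactly one coordinate and agree in the others). Let $W=W_n$ be the set of edges. $\Gamma$ is the set of admissible paths: simple closed paths (no repeated vertices other than the closing one, no repeated edges) that wrap around the torus exactly once in the direction $x_1$, i.e. traversed in a suitable orientation, the number of $+e_1$ steps minus the number of $-e_1$ steps equals $n$. $\Omega=\Omega_n=\{a,b\}^{W}$ carries the product measure with $\mathbb P(\omega_e=a)=p$, $\mathbb P(\omega_e=b)=1-p$ for each edge $e$, independently. $T(\gamma,\omega)=\sum_{e\in\gamma}\omega_e$ and $f^\tau(\omega)=f_n^\tau(\omega)=\min\{T(\gamma,\omega):\gamma\in\Gamma\}$. For $j\in W$, $\delta\in\{a,b\}$, $\sigma_j^\delta:\Omega\to\Omega$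 replaces $\omega_j$ by $\delta$; $\partial_j\varphi=\varphi\circ\sigma_j^b-\varphi\circ\sigma_j^a$; $\partial_{\{i,j\}}\varphi=\partial_i\partial_j\varphi$ for $i\ne j$. $\|g\|_2=(\mathbb E[|g|^2])^{1/2}$. A pair $\{i,j\}$ of distinct edges is called convoluted on $\omega$ if $\partial_i\partial_jf^\tau(\omega)\neq0$; $N_2(\omega)$ is the number of (unordered) convoluted pairs on $\omega$. *)

theory Defs
  imports "HOL-Probability.Probability"
begin

type_synonym vertex = "nat \<Rightarrow> int"
type_synonym edge = "vertex \<times> nat"
type_synonym config = "edge \<Rightarrow> real"

section \<open>The discrete torus\<close>

text \<open>Vertices are represented by their canonical residues, with coordinates indexed by
  \<open>{1..d}\<close>. The pair \<open>(x, k)\<close> is the edge joining \<open>x\<close> and \<open>x + e\<^sub>k\<close>.\<close>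

definition torus_vertices :: "nat \<Rightarrow> nat \<Rightarrow> vertex set" where
  "torus_vertices d n = {1..d} \<rightarrow>\<^sub>E {0..<int n}"

definition torus_edges :: "nat \<Rightarrow> nat \<Rightarrow> edge set" where
  "torus_edges d n = torus_vertices d n \<times> {1..d}"

definition torus_shift :: "nat \<Rightarrow> vertex \<Rightarrow> nat \<Rightarrow> int \<Rightarrow> vertex" where
  "torus_shift n x k s = x(k := (x k + s) mod int n)"


section \<open>Admissible paths\<close>

text \<open>A path is a starting vertex together with a list of steps; the step \<open>(k, s)\<close> with
  \<open>s \<in> {1, -1}\<close> goes from the current vertex \<open>x\<close> to \<open>x + s e\<^sub>k\<close>.
  For \<open>s = -1\<close> the edge traversed is therefore \<open>(x - e\<^sub>k, k)\<close>.\<close>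

type_synonym path = "vertex \<times> (nat \<times> int) list"

fun walk_vertices :: "nat \<Rightarrow> vertex \<Rightarrow> (nat \<times> int) list \<Rightarrow> vertex list" where
  "walk_vertices n x [] = [x]"
| "walk_vertices n x ((k, s) # ss) = x # walk_vertices n (torus_shift n x k s) ss"

fun walk_edges :: "nat \<Rightarrow> vertex \<Rightarrow> (nat \<times> int) list \<Rightarrow> edge list" where
  "walk_edges n x [] = []"
| "walk_edges n x ((k, s) # ss) =
     (if s = 1 then (x, k) else (torus_shift n x k s, k)) # walk_edges n (torus_shift n x k s) ss"

definition simple_closed_path :: "nat \<Rightarrow> nat \<Rightarrow> path \<Rightarrow> bool" where
  "simple_closed_path d n = (\<lambda>(x, ss).
     x \<in> torus_vertices d n \<and>
     set ss \<subseteq> {1..d} \<times> {1, -1} \<and>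
     last (walk_vertices n x ss) = x \<and>
     distinct (butlast (walk_vertices n x ss)) \<and>
     distinct (walk_edges n x ss))"

definition net_steps1 :: "path \<Rightarrow> int" where
  "net_steps1 = (\<lambda>(x, ss). int (count_list ss (1, 1)) - int (count_list ss (1, -1)))"

text \<open>Reversing the orientation of a path changes the sign of \<^const>\<open>net_steps1\<close>, so
  the absolute value expresses that one of the two orientations has net number of steps \<open>n\<close>.\<close>

definition admissible_paths :: "nat \<Rightarrow> nat \<Rightarrow> path set" where
  "admissible_paths d n = {\<gamma>. simple_closed_path d n \<gamma> \<and> \<bar>net_steps1 \<gamma>\<bar> = int n}"


section \<open>Passage times\<close>

definition path_edges :: "nat \<Rightarrow> path \<Rightarrow> edge set" where
  "path_edges n = (\<lambda>(x, ss). set (walk_edges n x ss))"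

definition path_time :: "nat \<Rightarrow> path \<Rightarrow> config \<Rightarrow> real" where
  "path_time n \<gamma> \<omega> = (\<Sum>e\<in>path_edges n \<gamma>. \<omega> e)"

definition torus_time :: "nat \<Rightarrow> nat \<Rightarrow> config \<Rightarrow> real" where
  "torus_time d n \<omega> = Min ((\<lambda>\<gamma>. path_time n \<gamma> \<omega>) ` admissible_paths d n)"

definition torus_pmf :: "nat \<Rightarrow> nat \<Rightarrow> real \<Rightarrow> real \<Rightarrow> real \<Rightarrow> config pmf" where
  "torus_pmf d n a b p =
     Pi_pmf (torus_edges d n) undefined
       (\<lambda>_. map_pmf (\<lambda>c. if c then a else b) (bernoulli_pmf p))"


section \<open>Discrete derivatives and convoluted pairs\<close>

definition subst_edge :: "edge \<Rightarrow> real \<Rightarrow> config \<Rightarrow> config" where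
  "subst_edge j \<delta> w = w(j := \<delta>)"

definition partial :: "real \<Rightarrow> real \<Rightarrow> edge \<Rightarrow> (config \<Rightarrow> real) \<Rightarrow> config \<Rightarrow> real" where
  "partial a b j \<phi> = (\<lambda>\<omega>. (\<phi> \<circ> subst_edge j b) \<omega> - (\<phi> \<circ> subst_edge j a) \<omega>)"

text \<open>The iterated derivative over a finite set of edges; the order is irrelevant because the
  operators commute.\<close>

definition partial_set ::
    "real \<Rightarrow> real \<Rightarrow> edge set \<Rightarrow> (config \<Rightarrow> real) \<Rightarrow> config \<Rightarrow> real" where
  "partial_set a b M \<phi> = Finite_Set.fold (partial a b) \<phi> M"

definition convoluted :: "nat \<Rightarrow> nat \<Rightarrow> real \<Rightarrow> real \<Rightarrow> config \<Rightarrow> edge \<Rightarrow> edge \<Rightarrow> bool" where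
  "convoluted d n a b \<omega> i j \<longleftrightarrow>
     i \<in> torus_edges d n \<and> j \<in> torus_edges d n \<and> i \<noteq> j \<and>
     partial a b i (partial a b j (torus_time d n)) \<omega> \<noteq> 0"

definition num_convoluted :: "nat \<Rightarrow> nat \<Rightarrow> real \<Rightarrow> real \<Rightarrow> config \<Rightarrow> nat" where
  "num_convoluted d n a b \<omega> = card {{i, j} | i j. convoluted d n a b \<omega> i j}"

definition l2_norm :: "'a pmf \<Rightarrow> ('a \<Rightarrow> real) \<Rightarrow> real" where
  "l2_norm P g = sqrt (measure_pmf.expectation P (\<lambda>\<omega>. \<bar>g \<omega>\<bar>\<^sup>2))"


section \<open>Well-definedness\<close>

lemma partial_commute:
  "partial a b i (partial a b j \<phi>) = partial a b j (partial a b i \<phi>)"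
  by (cases "i = j") (auto simp: partial_def subst_edge_def fun_upd_twist fun_eq_iff)

lemma partial_set_pair:
  assumes "i \<noteq> j"
  shows "partial_set a b {i, j} \<phi> = partial a b i (partial a b j \<phi>)"
proof -
  interpret comp_fun_commute "partial a b"
    by standard (simp add: fun_eq_iff partial_commute[of a b _ _] comp_def)
  show ?thesis
    using assms by (simp add: partial_set_def)
qed

lemma finite_torus_edges: "finite (torus_edges d n)"
  by (simp add: torus_edges_def torus_vertices_def finite_PiE)

lemma length_walk_edges: "length (walk_edges n x ss) = length ss"
  by (induction n x ss rule: walk_edges.induct) auto

lemma torus_shift_in_torus_vertices:
  assumes "x \<in> torus_vertices d n" "k \<in> {1..d}"
  shows "torus_shift n x k s \<in> torus_vertices d n"
proof -
  have "0 \<le> x k" "x k < int n"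
    using assms unfolding torus_vertices_def by (auto dest: PiE_mem)
  hence "0 < int n" by linarith
  thus ?thesis
    using assms unfolding torus_vertices_def torus_shift_def
    by (auto simp: PiE_iff extensional_def)
qed

lemma walk_edges_in_torus_edges:
  assumes "x \<in> torus_vertices d n" "set ss \<subseteq> {1..d} \<times> {1, -1}"
  shows "set (walk_edges n x ss) \<subseteq> torus_edges d n"
  using assms
  by (induction n x ss rule: walk_edges.induct)
     (auto simp: torus_edges_def torus_shift_in_torus_vertices)

lemma finite_admissible_paths: "finite (admissible_paths d n)"
proof -
  let ?L = "{ss. set ss \<subseteq> {1..d} \<times> {1, -1} \<and> length ss \<le> card (torus_edges d n)}"
  have "length ss \<le> card (torus_edges d n)" if "simple_closed_path d n (x, ss)" for x ss
    using that walk_edges_in_torus_edges[of x d n ss]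
    by (auto simp: simple_closed_path_def length_walk_edges[of n x ss, symmetric]
        simp flip: distinct_card intro!: card_mono finite_torus_edges)
  hence "admissible_paths d n \<subseteq> torus_vertices d n \<times> ?L"
    by (auto simp: admissible_paths_def simple_closed_path_def)
  moreover have "finite (torus_vertices d n \<times> ?L)"
    by (intro finite_cartesian_product finite_lists_length_le)
       (auto simp: torus_vertices_def finite_PiE)
  ultimately show ?thesis by (rule finite_subset)
qed

lemma torus_shift_torus_shift:
  "torus_shift n (torus_shift n x k s) k t = torus_shift n x k (s + t)"
  by (simp add: torus_shift_def mod_simps add.assoc)

lemma walk_straight:
  "walk_vertices n x (replicate m (k, 1)) =
     map (\<lambda>i. if i = 0 then x else torus_shift n x k (int i)) [0..<Suc m]"
  "walk_edges n x (replicate m (k, 1)) =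
     map (\<lambda>i. (if i = 0 then x else torus_shift n x k (int i), k)) [0..<m]"
proof (induction m arbitrary: x)
  case 0
  { case 1 show ?case by simp next case 2 show ?case by simp }
next
  case (Suc m)
  have *: "(if i = 0 then torus_shift n x k 1
            else torus_shift n (torus_shift n x k 1) k (int i)) =
      torus_shift n x k (int (Suc i))" for i
    by (auto simp: torus_shift_torus_shift)
  {
    case 1
    show ?case
      unfolding replicate_Suc walk_vertices.simps Suc.IH(1) *
      by (subst (2) upt_conv_Cons) (auto simp: torus_shift_torus_shift simp flip: map_Suc_upt simp del: upt_Suc)
  next
    case 2
    show ?case
      unfolding replicate_Suc walk_edges.simps Suc.IH(2) *
      by (subst (2) upt_conv_Cons) (auto simp: torus_shift_torus_shift simp flip: map_Suc_upt simp del: upt_Suc)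
  }
qed

lemma admissible_paths_nonempty:
  assumes "d \<ge> 1" "n \<ge> 1"
  shows "admissible_paths d n \<noteq> {}"
proof -
  define x :: vertex where "x = (\<lambda>k\<in>{1..d}. 0)"
  define v where "v = (\<lambda>i::nat. if i = 0 then x else torus_shift n x 1 (int i))"
  have v1: "v i 1 = int i" if "i < n" for i
    using that assms by (auto simp: v_def x_def torus_shift_def)
  have "inj_on v {0..<n}"
    by (rule inj_onI) (metis v1 atLeastLessThan_iff of_nat_eq_iff)
  hence dv: "distinct (map v [0..<n])" and de: "distinct (map (\<lambda>i. (v i, 1::nat)) [0..<n])"
    by (auto simp: distinct_map inj_on_def)
  have vn: "v n = x"
    using assms by (auto simp: v_def x_def torus_shift_def fun_eq_iff)
  have x: "x \<in> torus_vertices d n"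
    using assms by (auto simp: x_def torus_vertices_def)
  have wv: "walk_vertices n x (replicate n (1, 1)) = map v [0..<n] @ [x]"
    using vn walk_straight(1)[of n x n 1, folded v_def] by simp
  have we: "walk_edges n x (replicate n (1, 1)) = map (\<lambda>i. (v i, 1)) [0..<n]"
    by (simp add: walk_straight v_def)
  have "count_list (replicate n c) c = n" for c :: "nat \<times> int"
    by (induction n) auto
  moreover have "count_list (replicate n (1, 1)) (1::nat, -1::int) = 0"
    by (rule count_notin) auto
  ultimately have "net_steps1 (x, replicate n (1, 1)) = int n"
    by (simp only: net_steps1_def prod.case)
  moreover have "simple_closed_path d n (x, replicate n (1, 1))"
    unfolding simple_closed_path_def prod.case wv we using dv de x assms by auto
  ultimately have "(x, replicate n (1, 1)) \<in> admissible_paths d n"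
    by (simp add: admissible_paths_def)
  thus ?thesis by blast
qed

end

theory Submission
  imports Defs
begin

text \<open>The proof is Fourier analysis on the biased cube \<open>{a, b}\<^sup>W\<close>. Expand \<open>f\<close> in the orthonormal
  Walsh functions, so that the variance is the sum of the squared coefficients over the nonempty sets
  of edges, and treat level one and the levels from two on separately (\<open>variance_level_split\<close>).

  Level one consists of the squares of the mean derivatives. A derivative at \<open>j\<close> can be nonzero only if
  \<open>j\<close> lies on every geodesic of the configuration in which \<open>j\<close> is cheap, and a geodesic has at most
  \<open>n b / a\<close> edges; so the influences \<open>P(\<partial>\<^sub>j f \<noteq> 0)\<close> add up to \<open>O(n)\<close> (\<open>sum_influence_le\<close>). By
  translation invariance the \<open>n^d\<close> parallel edges share this total equally, hence each influence is
  \<open>O(n^(1 - d))\<close>, which is \<open>O(1/n)\<close> because \<open>d \<ge> 2\<close> (\<open>influence_le\<close>). The product of the two bounds is a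
  constant, and this constant is the additive term \<open>C'\<close>.

  For the higher levels, the coefficients of \<open>\<partial>\<^sub>M f\<close>, with \<open>M\<close> a pair, are up to the factor \<open>p (1 - p)\<close> those of
  \<open>f\<close> at the sets containing \<open>M\<close>. A set of size more than \<open>k + 2\<close> contains at least \<open>(k + 1)\<^sup>2 / 2\<close> pairs, so
  beyond that level the sum of the \<open>\<parallel>\<partial>\<^sub>M f\<parallel>\<^sup>2\<close> counts each coefficient that often, which is the gain
  wanted when \<open>k\<close> is of order \<open>log n\<close>. On the lower levels the gain comes from hypercontractivity: \<open>\<partial>\<^sub>M f\<close>
  vanishes outside an event of probability \<open>q = O(1/n)\<close>, and a function with small support has only a fraction
  \<open>sqrt q B^k\<close> of its squared norm on the levels up to \<open>k\<close> (\<open>level_inequality\<close>). With \<open>B^k \<le> n^(1/4)\<close> this is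
  smaller than any power of \<open>1 / log n\<close>. The two gains are combined in \<open>second_order_weight\<close>.

  The second inequality holds because \<open>0 \<le> \<partial>\<^sub>j f \<le> b - a\<close>, so that \<open>(\<partial>\<^sub>M f)\<^sup>2\<close> is at most \<open>(b - a)\<^sup>2\<close>
  times the indicator of \<open>M\<close> being convoluted.\<close>

section \<open>Fourier analysis on the biased cube\<close>

locale biased_cube =
  fixes I :: "edge set" and a b p :: real
  assumes finite_I: "finite I" and ab: "a < b" and p: "0 < p" "p < 1"
begin

definition law :: "config pmf" where
  "law = Pi_pmf I undefined (\<lambda>_. map_pmf (\<lambda>c. if c then a else b) (bernoulli_pmf p))"

abbreviation E :: "(config \<Rightarrow> real) \<Rightarrow> real" where
  "E \<phi> \<equiv> measure_pmf.expectation law \<phi>"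

text \<open>The centred and normalised value of an edge; it equals \<open>- sqrt ((1 - p) / p)\<close> at \<open>a\<close> and
  \<open>sqrt (p / (1 - p))\<close> at \<open>b\<close>.\<close>

definition chi :: "real \<Rightarrow> real" where
  "chi x = (x - (p * a + (1 - p) * b)) / ((b - a) * sqrt (p * (1 - p)))"

definition walsh :: "edge set \<Rightarrow> config \<Rightarrow> real" where
  "walsh S w = (\<Prod>i\<in>S. chi (w i))"

definition coeff :: "(config \<Rightarrow> real) \<Rightarrow> edge set \<Rightarrow> real" where
  "coeff \<phi> S = E (\<lambda>w. \<phi> w * walsh S w)"

lemma set_law: "set_pmf law = PiE_dflt I undefined (\<lambda>_. {a, b})"
proof -
  have "set_pmf (bernoulli_pmf p) = UNIV"
    using p by (simp add: set_pmf_bernoulli)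
  thus ?thesis
    by (simp add: law_def set_Pi_pmf finite_I comp_def UNIV_bool insert_commute)
qed

lemma finite_law: "finite (set_pmf law)"
  unfolding set_law by (rule finite_PiE_dflt) (auto simp: finite_I)

lemma integrable_law [simp]: "integrable (measure_pmf law) (\<phi> :: config \<Rightarrow> real)"
  by (rule integrable_measure_pmf_finite[OF finite_law])

lemma law_edge: "w \<in> set_pmf law \<Longrightarrow> i \<in> I \<Longrightarrow> w i = a \<or> w i = b"
  unfolding set_law PiE_dflt_def by blast

lemma law_outside: "w \<in> set_pmf law \<Longrightarrow> i \<notin> I \<Longrightarrow> w i = undefined"
  unfolding set_law PiE_dflt_def by blast

lemma E_cong: "(\<And>w. w \<in> set_pmf law \<Longrightarrow> \<phi> w = \<psi> w) \<Longrightarrow> E \<phi> = E \<psi>"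
  by (intro integral_cong_AE) (auto simp: AE_measure_pmf_iff)

lemma E_mono: "(\<And>w. w \<in> set_pmf law \<Longrightarrow> \<phi> w \<le> \<psi> w) \<Longrightarrow> E \<phi> \<le> E \<psi>"
  by (intro integral_mono_AE) (auto simp: AE_measure_pmf_iff)

lemma E_nonneg: "(\<And>w. \<phi> w \<ge> 0) \<Longrightarrow> E \<phi> \<ge> 0"
  by simp

text \<open>Independence enters the Fourier analysis only through this identity: refreshing the edge \<open>i\<close> does not
  change the law.\<close>

lemma E_resample:
  assumes "i \<in> I"
  shows "E \<phi> = E (\<lambda>w. p * \<phi> (w(i := a)) + (1 - p) * \<phi> (w(i := b)))"
proof -
  define L where "L = Pi_pmf (I - {i}) undefined
    (\<lambda>_. map_pmf (\<lambda>c. if c then a else b) (bernoulli_pmf p))"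
  define G where "G (\<psi> :: config \<Rightarrow> real) x = measure_pmf.expectation L (\<lambda>w. \<psi> (w(i := x)))" for \<psi> x
  have law: "law = bernoulli_pmf p \<bind> (\<lambda>c. map_pmf (\<lambda>w. w(i := if c then a else b)) L)"
    using Pi_pmf_insert'[of "I - {i}" i undefined
      "\<lambda>_. map_pmf (\<lambda>c. if c then a else b) (bernoulli_pmf p)"] assms finite_I
    by (simp add: law_def L_def insert_absorb map_pmf_def bind_assoc_pmf bind_return_pmf)
  have fin: "finite (set_pmf L)"
    unfolding L_def by (subst set_Pi_pmf) (auto intro!: finite_PiE_dflt simp: finite_I)
  have split: "E \<psi> = p * G \<psi> a + (1 - p) * G \<psi> b" for \<psi>
    unfolding law by (subst pmf_expectation_bind[of UNIV]) (use p fin in \<open>auto simp: UNIV_bool G_def\<close>)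
  have 1: "E (\<lambda>w. \<phi> (w(i := x))) = G \<phi> x" for x
    by (subst split) (simp add: G_def algebra_simps)
  show ?thesis
    by (subst split) (simp add: 1)
qed

lemma E_upd_le:
  assumes "i \<in> I" "\<And>w. 0 \<le> \<phi> w"
  shows "p * E (\<lambda>w. \<phi> (w(i := a))) \<le> E \<phi>" "(1 - p) * E (\<lambda>w. \<phi> (w(i := b))) \<le> E \<phi>"
proof -
  have "E \<phi> = p * E (\<lambda>w. \<phi> (w(i := a))) + (1 - p) * E (\<lambda>w. \<phi> (w(i := b)))"
    by (subst E_resample[OF assms(1)]) simp
  moreover have "0 \<le> p * E (\<lambda>w. \<phi> (w(i := a)))" "0 \<le> (1 - p) * E (\<lambda>w. \<phi> (w(i := b)))"
    using p assms(2) by (auto intro!: mult_nonneg_nonneg E_nonneg)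
  ultimately show "p * E (\<lambda>w. \<phi> (w(i := a))) \<le> E \<phi>"
    "(1 - p) * E (\<lambda>w. \<phi> (w(i := b))) \<le> E \<phi>" by linarith+
qed

lemma chi_moments:
  "p * chi a + (1 - p) * chi b = 0"
  "p * (chi a)\<^sup>2 + (1 - p) * (chi b)\<^sup>2 = 1"
  "p * chi a = - sqrt (p * (1 - p))"
  "(1 - p) * chi b = sqrt (p * (1 - p))"
proof -
  define s where "s = sqrt (p * (1 - p))"
  have s: "s > 0" "s * s = p * (1 - p)" using p by (auto simp: s_def)
  have "a - (p * a + (1 - p) * b) = (b - a) * (- (1 - p))"
    "b - (p * a + (1 - p) * b) = (b - a) * p" by algebra+
  hence a: "chi a = - (1 - p) / s" and b: "chi b = p / s"
    using ab by (simp_all only: chi_def s_def[symmetric]) simp_all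
  have "p * (chi a)\<^sup>2 + (1 - p) * (chi b)\<^sup>2 = (p * (1 - p)) / (s * s)"
    unfolding a b power_divide power2_eq_square using s(1) 
    by (simp add: field_simps)
  thus "p * (chi a)\<^sup>2 + (1 - p) * (chi b)\<^sup>2 = 1" using s p by simp
  show "p * chi a = - sqrt (p * (1 - p))" "(1 - p) * chi b = sqrt (p * (1 - p))"
    unfolding a b s_def[symmetric] using s by (simp_all add: field_simps)
  thus "p * chi a + (1 - p) * chi b = 0" by simp
qed

text \<open>The kernel \<open>1 + chi x chi y\<close> is the indicator of \<open>x = y\<close> divided by the probability of that
  value, so integrating against it evaluates a function. Its product over all edges is a delta
  function on the cube, whose expansion yields the completeness of the Walsh functions.\<close>

lemma chi_prod_eq_delta:
  assumes "x = a \<or> x = b"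
  shows "p * (1 + chi a * chi x) * \<phi> a + (1 - p) * (1 + chi b * chi x) * \<phi> b = \<phi> x"
proof -
  have a: "p * (1 + chi a * chi x) = p - sqrt (p * (1 - p)) * chi x"
    using chi_moments(3) by (simp add: distrib_left flip: mult.assoc)
  have b: "(1 - p) * (1 + chi b * chi x) = 1 - p + sqrt (p * (1 - p)) * chi x"
    using chi_moments(4) by (simp add: distrib_left flip: mult.assoc)
  have ss: "sqrt (p * (1 - p)) * chi a = - (1 - p)" "sqrt (p * (1 - p)) * chi b = p"
  proof -
    have s: "sqrt (p * (1 - p)) * sqrt (p * (1 - p)) = p * (1 - p)" using p by simp
    have "p * (sqrt (p * (1 - p)) * chi a) = p * (- (1 - p))"
      using chi_moments(3) s by (metis mult.left_commute mult_minus_right)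
    thus "sqrt (p * (1 - p)) * chi a = - (1 - p)" using p by simp
    have "(1 - p) * (sqrt (p * (1 - p)) * chi b) = (1 - p) * p"
      using chi_moments(4) s by (metis mult.left_commute mult.commute)
    thus "sqrt (p * (1 - p)) * chi b = p" using p by simp
  qed
  show ?thesis using assms unfolding a b by (auto simp: ss)
qed

lemma walsh_empty [simp]: "walsh {} w = 1"
  by (simp add: walsh_def)

lemma walsh_insert:
  "finite S \<Longrightarrow> i \<notin> S \<Longrightarrow> walsh (insert i S) w = chi (w i) * walsh S w"
  by (simp add: walsh_def)

lemma walsh_upd [simp]: "i \<notin> S \<Longrightarrow> walsh S (w(i := x)) = walsh S w"
  unfolding walsh_def by (rule prod.cong) auto

lemma E_edge_times:
  assumes "i \<in> I" "\<And>w x. \<psi> (w(i := x)) = \<psi> w"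
  shows "E (\<lambda>w. g (w i) * \<psi> w) = (p * g a + (1 - p) * g b) * E \<psi>"
proof -
  have "E (\<lambda>w. g (w i) * \<psi> w) = E (\<lambda>w. (p * g a + (1 - p) * g b) * \<psi> w)"
    by (subst E_resample[OF assms(1)]) (simp add: assms(2) algebra_simps)
  thus ?thesis by simp
qed

text \<open>If the sets differ, some edge occurs in the product exactly once and its factor has mean zero;
  if they agree, every factor is a square of mean one.\<close>

lemma walsh_orthonormal:
  assumes "S \<subseteq> I" "T \<subseteq> I"
  shows "E (\<lambda>w. walsh S w * walsh T w) = of_bool (S = T)"
proof -
  have fin: "finite S" "finite T" using assms finite_I by (auto intro: finite_subset)
  have zero: "E (\<lambda>w. walsh S w * walsh T w) = 0"
    if i: "i \<in> S" "i \<notin> T" and fin: "finite S" and I: "S \<subseteq> I" for i S T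
  proof -
    have "E (\<lambda>w. walsh S w * walsh T w) =
        E (\<lambda>w. chi (w i) * (walsh (S - {i}) w * walsh T w))"
      using walsh_insert[of "S - {i}" i] i fin by (simp add: insert_absorb mult.assoc)
    also have "\<dots> = 0"
      using i I by (subst E_edge_times) (auto simp: chi_moments)
    finally show ?thesis .
  qed
  have one: "E (\<lambda>w. walsh S w * walsh S w) = 1" if "finite S" "S \<subseteq> I" for S
    using that
  proof (induction S rule: finite_induct)
    case (insert i S)
    have "E (\<lambda>w. walsh (insert i S) w * walsh (insert i S) w) =
        E (\<lambda>w. (chi (w i))\<^sup>2 * (walsh S w * walsh S w))"
      using insert by (simp add: walsh_insert power2_eq_square algebra_simps)
    also have "\<dots> = 1"
      using insert by (subst E_edge_times[where g = "\<lambda>x. (chi x)\<^sup>2"]) (auto simp: chi_moments)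
    finally show ?case .
  qed simp
  show ?thesis
  proof (cases "S = T")
    case False
    then consider i where "i \<in> S" "i \<notin> T" | i where "i \<in> T" "i \<notin> S" by blast
    thus ?thesis
    proof cases
      case 1 thus ?thesis using zero[OF 1] fin assms False by simp
    next
      case 2 thus ?thesis using zero[OF 2] fin assms False by (simp add: mult.commute)
    qed
  qed (use one fin assms in auto)
qed

lemma E_kernel:
  assumes "w \<in> set_pmf law" "A \<subseteq> I"
  shows "E (\<lambda>\<eta>. \<phi> \<eta> * (\<Prod>i\<in>A. 1 + chi (\<eta> i) * chi (w i))) = E (\<lambda>\<eta>. \<phi> (override_on \<eta> w A))"
proof -
  have "finite A" using assms finite_I by (auto intro: finite_subset)
  thus ?thesis using assms(2)
  proof (induction A arbitrary: \<phi> rule: finite_induct)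
    case (insert i A)
    define K where "K \<eta> = (\<Prod>j\<in>A. 1 + chi (\<eta> j) * chi (w j))" for \<eta> :: config
    have K: "K (\<eta>(i := x)) = K \<eta>" for \<eta> x
      unfolding K_def using insert.hyps by (intro prod.cong) auto
    have "E (\<lambda>\<eta>. \<phi> \<eta> * (\<Prod>j\<in>insert i A. 1 + chi (\<eta> j) * chi (w j))) =
        E (\<lambda>\<eta>. \<phi> \<eta> * ((1 + chi (\<eta> i) * chi (w i)) * K \<eta>))"
      using insert.hyps by (simp add: K_def)
    also have "\<dots> = E (\<lambda>\<eta>. (p * (1 + chi a * chi (w i)) * \<phi> (\<eta>(i := a)) +
          (1 - p) * (1 + chi b * chi (w i)) * \<phi> (\<eta>(i := b))) * K \<eta>)"
      using insert.prems
      by (subst E_resample[of i], simp, intro E_cong) (simp add: K, simp add: algebra_simps)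
    also have "\<dots> = E (\<lambda>\<eta>. \<phi> (\<eta>(i := w i)) * K \<eta>)"
      using law_edge[OF assms(1), of i] insert.prems
      by (subst chi_prod_eq_delta[where \<phi> = "\<lambda>x. \<phi> (_(i := x))"]) auto
    also have "\<dots> = E (\<lambda>\<eta>. \<phi> ((override_on \<eta> w A)(i := w i)))"
      using insert by (simp add: K_def)
    finally show ?case by (simp only: override_on_insert)
  qed simp
qed

text \<open>Multiplying out the kernel over all edges gives the sum of \<open>walsh S \<eta> * walsh S w\<close> over all
  subsets \<open>S\<close>.\<close>

lemma walsh_expansion:
  assumes "w \<in> set_pmf law"
  shows "\<phi> w = (\<Sum>S\<in>Pow I. coeff \<phi> S * walsh S w)"
proof -
  have kernel: "(\<Prod>i\<in>I. 1 + chi (\<eta> i) * chi (w i)) = (\<Sum>S\<in>Pow I. walsh S \<eta> * walsh S w)" for \<eta>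
    using prod_add[OF finite_I, of "\<lambda>i. chi (\<eta> i) * chi (w i)" "\<lambda>_. 1"]
    by (simp add: walsh_def prod.distrib add.commute)
  have "(\<Sum>S\<in>Pow I. coeff \<phi> S * walsh S w) =
      (\<Sum>S\<in>Pow I. E (\<lambda>\<eta>. \<phi> \<eta> * walsh S \<eta> * walsh S w))"
    by (simp add: coeff_def)
  also have "\<dots> = E (\<lambda>\<eta>. \<phi> \<eta> * (\<Prod>i\<in>I. 1 + chi (\<eta> i) * chi (w i)))"
    unfolding kernel sum_distrib_left mult.assoc[symmetric]
    by (subst Bochner_Integration.integral_sum) auto
  also have "\<dots> = E (\<lambda>\<eta>. \<phi> (override_on \<eta> w I))"
    by (rule E_kernel[OF assms]) simp
  also have "\<dots> = E (\<lambda>\<eta>. \<phi> w)"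
  proof (rule E_cong)
    fix \<eta> assume "\<eta> \<in> set_pmf law"
    hence "override_on \<eta> w I = w"
      using assms by (auto simp: override_on_def law_outside)
    thus "\<phi> (override_on \<eta> w I) = \<phi> w" by simp
  qed
  finally show ?thesis by simp
qed

lemma E_walsh_sum_square:
  assumes "F \<subseteq> Pow I"
  shows "E (\<lambda>w. (\<Sum>S\<in>F. c S * walsh S w)\<^sup>2) = (\<Sum>S\<in>F. (c S)\<^sup>2)"
proof -
  have fin: "finite F" using assms finite_I by (meson finite_Pow_iff finite_subset)
  have "E (\<lambda>w. (\<Sum>S\<in>F. c S * walsh S w)\<^sup>2) =
      (\<Sum>S\<in>F. \<Sum>T\<in>F. c S * c T * E (\<lambda>w. walsh S w * walsh T w))"
  proof -
    have "(\<Sum>S\<in>F. c S * walsh S w)\<^sup>2 =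
        (\<Sum>S\<in>F. \<Sum>T\<in>F. c S * c T * (walsh S w * walsh T w))" for w
      unfolding power2_eq_square sum_product by (intro sum.cong refl) (simp only: mult_ac)
    thus ?thesis by (simp add: Bochner_Integration.integral_sum)
  qed
  also have "\<dots> = (\<Sum>S\<in>F. \<Sum>T\<in>F. c S * c T * of_bool (S = T))"
    using assms by (intro sum.cong) (auto simp: walsh_orthonormal subset_iff)
  also have "\<dots> = (\<Sum>S\<in>F. (c S)\<^sup>2)"
    using fin by (simp add: of_bool_def if_distrib power2_eq_square cong: if_cong)
  finally show ?thesis .
qed

lemma parseval: "E (\<lambda>w. (\<phi> w)\<^sup>2) = (\<Sum>S\<in>Pow I. (coeff \<phi> S)\<^sup>2)"
proof -
  have "E (\<lambda>w. (\<phi> w)\<^sup>2) = E (\<lambda>w. (\<Sum>S\<in>Pow I. coeff \<phi> S * walsh S w)\<^sup>2)"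
    by (rule E_cong) (metis walsh_expansion)
  thus ?thesis by (simp add: E_walsh_sum_square)
qed

text \<open>Averaging over the edge \<open>i\<close> first, the weights \<open>p * chi a\<close> and \<open>(1 - p) * chi b\<close> are opposite, so
  the average against \<open>chi\<close> is a multiple of the discrete derivative.\<close>

lemma coeff_insert:
  assumes "i \<in> I" "S \<subseteq> I" "i \<notin> S"
  shows "coeff \<phi> (insert i S) = sqrt (p * (1 - p)) * coeff (partial a b i \<phi>) S"
proof -
  have fin: "finite S" using assms finite_I by (auto intro: finite_subset)
  have "coeff \<phi> (insert i S) = E (\<lambda>w. (p * chi a) * (\<phi> (w(i := a)) * walsh S w) +
      ((1 - p) * chi b) * (\<phi> (w(i := b)) * walsh S w))"
    unfolding coeff_def using assms fin
    by (subst E_resample[of i]) (auto simp: walsh_insert algebra_simps)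
  also have "\<dots> = E (\<lambda>w. sqrt (p * (1 - p)) * (partial a b i \<phi> w * walsh S w))"
    unfolding chi_moments(3,4) by (simp add: partial_def subst_edge_def algebra_simps)
  finally show ?thesis by (simp add: coeff_def)
qed

lemma partial_upd [simp]: "partial a b i \<phi> (w(i := x)) = partial a b i \<phi> w"
  by (simp add: partial_def subst_edge_def)

section \<open>Hypercontractivity\<close>

lemma E_Cauchy_Schwarz: "(E (\<lambda>w. \<phi> w * \<psi> w))\<^sup>2 \<le> E (\<lambda>w. (\<phi> w)\<^sup>2) * E (\<lambda>w. (\<psi> w)\<^sup>2)"
proof -
  have E: "E g = (\<Sum>w\<in>set_pmf law. g w * pmf law w)" for g :: "config \<Rightarrow> real"
    by (rule integral_measure_pmf_real[OF finite_law])
  have prod: "(\<phi> w * sqrt (pmf law w)) * (\<psi> w * sqrt (pmf law w)) = \<phi> w * \<psi> w * pmf law w" for w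
    using real_sqrt_mult_self[of "pmf law w"] by (simp add: mult_ac)
  have sq: "(g w * sqrt (pmf law w))\<^sup>2 = (g w)\<^sup>2 * pmf law w" for g :: "config \<Rightarrow> real" and w
    by (simp add: power_mult_distrib)
  show ?thesis
    using Cauchy_Schwarz_ineq_sum[of "\<lambda>w. \<phi> w * sqrt (pmf law w)"
        "\<lambda>w. \<psi> w * sqrt (pmf law w)" "set_pmf law"]
    by (simp only: E prod sq)
qed

text \<open>The fourth power is expanded in \<open>chi (w i)\<close>. The term with the third power of \<open>chi\<close>, which does not vanish
  for a biased edge, is split by the inequality \<open>2 u v \<le> u\<^sup>2 + v\<^sup>2\<close> between the second and the fourth
  power; this turns the binomial coefficients 6 and 1 into 8 and 3, whence the two conditions on \<open>B\<close>.\<close>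

lemma E_fourth_power_chi_step:
  assumes i: "i \<in> I" and h: "\<And>w x. h (w(i := x)) = h w" and r: "\<And>w x. r (w(i := x)) = r w"
    and X: "E (\<lambda>w. h w ^ 4) \<le> X\<^sup>2" "X \<ge> 0" and Y: "E (\<lambda>w. r w ^ 4) \<le> Y\<^sup>2" "Y \<ge> 0"
    and B: "B \<ge> 4" "3 * (p * (chi a) ^ 4 + (1 - p) * (chi b) ^ 4) \<le> B\<^sup>2"
  shows "E (\<lambda>w. (h w + chi (w i) * r w) ^ 4) \<le> (X + B * Y)\<^sup>2"
proof -
  define l where "l = p * (chi a) ^ 4 + (1 - p) * (chi b) ^ 4"
  have cs: "E (\<lambda>w. (h w)\<^sup>2 * (r w)\<^sup>2) \<le> X * Y"
  proof -
    have "(E (\<lambda>w. (h w)\<^sup>2 * (r w)\<^sup>2))\<^sup>2 \<le> E (\<lambda>w. ((h w)\<^sup>2)\<^sup>2) * E (\<lambda>w. ((r w)\<^sup>2)\<^sup>2)"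
      by (rule E_Cauchy_Schwarz)
    also have "\<dots> \<le> X\<^sup>2 * Y\<^sup>2"
      using X Y by (intro mult_mono) (auto simp: power_mult[symmetric])
    finally have "(E (\<lambda>w. (h w)\<^sup>2 * (r w)\<^sup>2))\<^sup>2 \<le> (X * Y)\<^sup>2" by (simp add: power_mult_distrib)
    thus ?thesis using X Y by (meson mult_nonneg_nonneg power2_le_imp_le)
  qed
  have pt: "(h + c * r) ^ 4 \<le> h ^ 4 + 4 * (c * (h ^ 3 * r)) + 8 * (c\<^sup>2 * (h\<^sup>2 * r\<^sup>2)) + 3 * (c ^ 4 * r ^ 4)"
    for h c r :: real
  proof -
    \<comment> \<open>The difference of the two sides is a square, by the splitting of the cubic term.\<close>
    have "h ^ 4 + 4 * (c * (h ^ 3 * r)) + 8 * (c\<^sup>2 * (h\<^sup>2 * r\<^sup>2)) + 3 * (c ^ 4 * r ^ 4) - (h + c * r) ^ 4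
        = 2 * (c * r * h - (c * r)\<^sup>2)\<^sup>2"
      by (simp add: power2_eq_square power3_eq_cube power4_eq_xxxx algebra_simps)
    thus ?thesis by (metis diff_ge_0_iff_ge zero_le_power2 mult_nonneg_nonneg zero_le_numeral)
  qed
  have "E (\<lambda>w. (h w + chi (w i) * r w) ^ 4) \<le>
      E (\<lambda>w. h w ^ 4 + 4 * (chi (w i) * (h w ^ 3 * r w)) +
        8 * ((chi (w i))\<^sup>2 * ((h w)\<^sup>2 * (r w)\<^sup>2)) + 3 * (chi (w i) ^ 4 * r w ^ 4))"
    by (rule E_mono) (rule pt)
  also have "\<dots> = E (\<lambda>w. h w ^ 4) + 8 * E (\<lambda>w. (h w)\<^sup>2 * (r w)\<^sup>2) + 3 * l * E (\<lambda>w. r w ^ 4)"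
    using E_edge_times[OF i, of "\<lambda>w. h w ^ 3 * r w" chi]
      E_edge_times[OF i, of "\<lambda>w. (h w)\<^sup>2 * (r w)\<^sup>2" "\<lambda>x. (chi x)\<^sup>2"]
      E_edge_times[OF i, of "\<lambda>w. r w ^ 4" "\<lambda>x. chi x ^ 4"]
    by (simp add: h r chi_moments l_def)
  also have "\<dots> \<le> X\<^sup>2 + (2 * B) * (X * Y) + B\<^sup>2 * Y\<^sup>2"
  proof -
    have "8 * E (\<lambda>w. (h w)\<^sup>2 * (r w)\<^sup>2) \<le> (2 * B) * (X * Y)"
      using cs B X Y by (intro mult_mono) auto
    moreover have "3 * l * E (\<lambda>w. r w ^ 4) \<le> B\<^sup>2 * Y\<^sup>2"
      using B Y by (intro mult_mono) (auto simp: l_def)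
    ultimately show ?thesis using X by linarith
  qed
  also have "\<dots> = (X + B * Y)\<^sup>2" by (simp add: power2_eq_square algebra_simps)
  finally show ?thesis .
qed

text \<open>The Bonami inequality between the second and the fourth norm, in the form that weighs level \<open>m\<close>
  by \<open>B ^ m\<close>. This form, without a restriction on the degree, is the one that passes through the
  induction on the edges.\<close>

lemma bonami:
  assumes B: "B \<ge> 4" "3 * (p * (chi a) ^ 4 + (1 - p) * (chi b) ^ 4) \<le> B\<^sup>2" and "A \<subseteq> I"
  shows "E (\<lambda>w. (\<Sum>S\<in>Pow A. c S * walsh S w) ^ 4) \<le> (\<Sum>S\<in>Pow A. B ^ card S * (c S)\<^sup>2)\<^sup>2"
proof -
  have "finite A" using assms finite_I by (auto intro: finite_subset)
  thus ?thesis using \<open>A \<subseteq> I\<close>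
  proof (induction A arbitrary: c rule: finite_induct)
    case empty
    show ?case by (simp add: power_mult[symmetric])
  next
    case (insert i A)
    have disj: "Pow A \<inter> insert i ` Pow A = {}" and inj: "inj_on (insert i) (Pow A)"
      using insert.hyps by (auto simp: inj_on_def)
    have split: "(\<Sum>S\<in>Pow (insert i A). g S) = (\<Sum>S\<in>Pow A. g S) + (\<Sum>S\<in>Pow A. g (insert i S))"
      for g :: "edge set \<Rightarrow> real"
      using insert.hyps disj inj by (simp add: Pow_insert sum.union_disjoint sum.reindex)
    have fin: "finite S" and ni: "i \<notin> S" if "S \<in> Pow A" for S
      using that insert.hyps by (auto intro: finite_subset)
    have g: "(\<Sum>S\<in>Pow (insert i A). c S * walsh S w) = (\<Sum>S\<in>Pow A. c S * walsh S w) +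
        chi (w i) * (\<Sum>S\<in>Pow A. c (insert i S) * walsh S w)" for w
      unfolding split using fin ni by (simp add: walsh_insert sum_distrib_left mult_ac)
    have w: "(\<Sum>S\<in>Pow (insert i A). B ^ card S * (c S)\<^sup>2) = (\<Sum>S\<in>Pow A. B ^ card S * (c S)\<^sup>2) +
        B * (\<Sum>S\<in>Pow A. B ^ card S * (c (insert i S))\<^sup>2)"
      unfolding split using fin ni by (simp add: sum_distrib_left mult_ac)
    show ?case unfolding g w
    proof (rule E_fourth_power_chi_step)
      show "i \<in> I" using insert.prems by simp
      show "(\<Sum>S\<in>Pow A. c S * walsh S (w(i := x))) = (\<Sum>S\<in>Pow A. c S * walsh S w)" for w x c
        using ni by (intro sum.cong) auto
      thus "(\<Sum>S\<in>Pow A. c (insert i S) * walsh S (w(i := x))) =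
          (\<Sum>S\<in>Pow A. c (insert i S) * walsh S w)" for w x .
    qed (use insert B in \<open>auto intro!: sum_nonneg mult_nonneg_nonneg\<close>)
  qed
qed


text \<open>Let \<open>h\<close> be the part of \<open>g\<close> on the levels up to \<open>k\<close>. Its squared norm is the inner product of \<open>g\<close> with
  \<open>h\<close>, and only the values of \<open>h\<close> on the support of \<open>g\<close> enter there. On a small event the squared norm of \<open>h\<close>
  is small by the Cauchy-Schwarz inequality, since the fourth moment of \<open>h\<close> is controlled by its
  second one.\<close>

lemma level_inequality:
  assumes B: "B \<ge> 4" "3 * (p * (chi a) ^ 4 + (1 - p) * (chi b) ^ 4) \<le> B\<^sup>2"
  shows "(\<Sum>R | R \<subseteq> I \<and> card R \<le> k. (coeff g R)\<^sup>2) \<le>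
    E (\<lambda>w. (g w)\<^sup>2) * sqrt (E (\<lambda>w. of_bool (g w \<noteq> 0))) * B ^ k"
proof -
  define F where "F = {R. R \<subseteq> I \<and> card R \<le> k}"
  define h where "h w = (\<Sum>R\<in>F. coeff g R * walsh R w)" for w
  define W where "W = (\<Sum>R\<in>F. (coeff g R)\<^sup>2)"
  define q where "q = E (\<lambda>w. of_bool (g w \<noteq> 0))"
  have sq: "(of_bool P)\<^sup>2 = (of_bool P :: real)" for P by (cases P) simp_all
  have F: "F \<subseteq> Pow I" "finite F" using finite_I by (auto simp: F_def)
  have W0: "W \<ge> 0" unfolding W_def by (simp add: sum_nonneg)
  have q0: "q \<ge> 0" unfolding q_def by (rule E_nonneg) simp
  have fourth: "E (\<lambda>w. h w ^ 4) \<le> (B ^ k * W)\<^sup>2"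
  proof -
    define c where "c R = of_bool (R \<in> F) * coeff g R" for R
    have "h w = (\<Sum>R\<in>Pow I. c R * walsh R w)" for w
      unfolding h_def using F finite_I by (intro sum.mono_neutral_cong_left) (auto simp: c_def)
    hence "E (\<lambda>w. h w ^ 4) \<le> (\<Sum>R\<in>Pow I. B ^ card R * (c R)\<^sup>2)\<^sup>2"
      using bonami[OF B, of I c] by simp
    also have "(\<Sum>R\<in>Pow I. B ^ card R * (c R)\<^sup>2) = (\<Sum>R\<in>F. B ^ card R * (coeff g R)\<^sup>2)"
      using F finite_I by (intro sum.mono_neutral_cong_right) (auto simp: c_def)
    also have "\<dots>\<^sup>2 \<le> (B ^ k * W)\<^sup>2"
    proof (rule power_mono)
      show "(\<Sum>R\<in>F. B ^ card R * (coeff g R)\<^sup>2) \<le> B ^ k * W"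
        unfolding W_def sum_distrib_left using B
        by (intro sum_mono mult_right_mono power_increasing) (auto simp: F_def)
    qed (use B in \<open>auto intro!: sum_nonneg\<close>)
    finally show ?thesis .
  qed
  have "(E (\<lambda>w. of_bool (g w \<noteq> 0) * (h w)\<^sup>2))\<^sup>2 \<le> q * E (\<lambda>w. h w ^ 4)"
  proof -
    have "((h w)\<^sup>2)\<^sup>2 = h w ^ 4" for w by (simp flip: power_mult)
    thus ?thesis
      using E_Cauchy_Schwarz[of "\<lambda>w. of_bool (g w \<noteq> 0)" "\<lambda>w. (h w)\<^sup>2"]
      by (simp only: q_def sq)
  qed
  also have "\<dots> \<le> q * (B ^ k * W)\<^sup>2"
    using fourth q0 by (rule mult_left_mono)
  also have "\<dots> = (sqrt q * (B ^ k * W))\<^sup>2" using q0 by (simp add: power_mult_distrib)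
  finally have small: "E (\<lambda>w. of_bool (g w \<noteq> 0) * (h w)\<^sup>2) \<le> sqrt q * (B ^ k * W)"
  proof (rule power2_le_imp_le)
    show "0 \<le> sqrt q * (B ^ k * W)"
      using q0 W0 B by (intro mult_nonneg_nonneg zero_le_power real_sqrt_ge_zero) linarith+
  qed
  \<comment> \<open>The inner product of \<open>g\<close> and \<open>h\<close>, restricted to the support of \<open>g\<close>.\<close>
  have "W = (\<Sum>R\<in>F. E (\<lambda>w. coeff g R * (g w * walsh R w)))"
    unfolding W_def by (simp add: power2_eq_square coeff_def)
  also have "\<dots> = E (\<lambda>w. g w * (of_bool (g w \<noteq> 0) * h w))"
  proof -
    have "(\<Sum>R\<in>F. coeff g R * (g w * walsh R w)) = g w * (of_bool (g w \<noteq> 0) * h w)" for w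
      unfolding h_def sum_distrib_left by (cases "g w = 0") (auto simp: mult_ac intro: sum.cong)
    thus ?thesis by (subst Bochner_Integration.integral_sum[symmetric]) simp_all
  qed
  finally have "W\<^sup>2 \<le> E (\<lambda>w. (g w)\<^sup>2) * E (\<lambda>w. of_bool (g w \<noteq> 0) * (h w)\<^sup>2)"
    using E_Cauchy_Schwarz[of g "\<lambda>w. of_bool (g w \<noteq> 0) * h w"]
    by (simp only: power_mult_distrib sq)
  also have "\<dots> \<le> E (\<lambda>w. (g w)\<^sup>2) * (sqrt q * (B ^ k * W))"
    by (intro mult_left_mono small E_nonneg) simp
  finally have "W * W \<le> (E (\<lambda>w. (g w)\<^sup>2) * sqrt q * B ^ k) * W"
    by (simp only: power2_eq_square[of W] mult.assoc)
  moreover have "E (\<lambda>w. (g w)\<^sup>2) * sqrt q * B ^ k \<ge> 0"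
    using q0 B by (intro mult_nonneg_nonneg[of "_ * _"] mult_nonneg_nonneg[of "E _"] zero_le_power
        real_sqrt_ge_zero E_nonneg zero_le_power2) linarith+
  ultimately have "W \<le> E (\<lambda>w. (g w)\<^sup>2) * sqrt q * B ^ k"
    using W0 mult_right_le_imp_le[of W W] by (cases "W = 0") (metis, metis order_less_le)
  thus ?thesis unfolding W_def F_def q_def .
qed

section \<open>Fourier weight and derivatives of order two\<close>

lemma coeff_pair:
  assumes "M \<subseteq> S" "S \<subseteq> I" "card M = 2"
  shows "coeff \<phi> S = p * (1 - p) * coeff (partial_set a b M \<phi>) (S - M)"
proof -
  obtain i j where M: "M = {i, j}" "i \<noteq> j" using assms(3) by (auto simp: card_2_iff)
  have S: "S = insert j (insert i (S - M))" using assms M by auto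
  have "coeff \<phi> S = coeff \<phi> (insert j (insert i (S - M)))" using S by metis
  also have "\<dots> = sqrt (p * (1 - p)) * coeff (partial a b j \<phi>) (insert i (S - M))"
    using assms M by (subst coeff_insert) auto
  also have "\<dots> = sqrt (p * (1 - p)) *
      (sqrt (p * (1 - p)) * coeff (partial a b i (partial a b j \<phi>)) (S - M))"
    using assms M by (subst coeff_insert) auto
  also have "\<dots> = p * (1 - p) * coeff (partial_set a b M \<phi>) (S - M)"
    using M p by (simp add: partial_set_pair flip: mult.assoc)
  finally show ?thesis .
qed

lemma sum_coeff_pair:
  assumes "\<And>S. S \<in> F \<Longrightarrow> M \<subseteq> S \<and> S \<subseteq> I" "card M = 2"
  shows "(\<Sum>S\<in>F. (coeff \<phi> S)\<^sup>2) =
    (p * (1 - p))\<^sup>2 * (\<Sum>R\<in>(\<lambda>S. S - M) ` F. (coeff (partial_set a b M \<phi>) R)\<^sup>2)"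
proof -
  have "inj_on (\<lambda>S. S - M) F" using assms(1) by (intro inj_onI) blast
  hence "(\<Sum>R\<in>(\<lambda>S. S - M) ` F. (coeff (partial_set a b M \<phi>) R)\<^sup>2) =
      (\<Sum>S\<in>F. (coeff (partial_set a b M \<phi>) (S - M))\<^sup>2)"
    by (simp add: sum.reindex)
  thus ?thesis
    using assms by (simp add: sum_distrib_left coeff_pair[of M] power_mult_distrib)
qed

lemma of_nat_choose_two: "real (n choose 2) = real n * real (n - 1) / 2"
proof (cases n)
  case (Suc m)
  have "2 dvd n * (n - 1)" unfolding Suc by simp
  from real_of_nat_div[OF this] show ?thesis unfolding choose_two of_nat_mult by simp
qed simp

text \<open>A second-order analogue of Talagrand's inequality, with the cutoff \<open>k\<close> left free. A set of size at most
  \<open>k + 2\<close> contains some pair \<open>M\<close>, and appears on a level up to \<open>k\<close> of the derivative at \<open>M\<close>, where the level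
  inequality applies; a larger set contains so many pairs that its share of each is small.\<close>

lemma second_order_weight:
  assumes B: "B \<ge> 4" "3 * (p * (chi a) ^ 4 + (1 - p) * (chi b) ^ 4) \<le> B\<^sup>2"
    and q: "\<And>M. M \<subseteq> I \<Longrightarrow> card M = 2 \<Longrightarrow> E (\<lambda>w. of_bool (partial_set a b M \<phi> w \<noteq> 0)) \<le> q"
  shows "(\<Sum>S | S \<subseteq> I \<and> 2 \<le> card S. (coeff \<phi> S)\<^sup>2) \<le>
    (p * (1 - p))\<^sup>2 * (2 / (real k + 1)\<^sup>2 + sqrt q * B ^ k) *
      (\<Sum>M | M \<subseteq> I \<and> card M = 2. E (\<lambda>w. (partial_set a b M \<phi> w)\<^sup>2))"
proof -
  define pairs where "pairs = {M. M \<subseteq> I \<and> card M = 2}"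
  define low where "low = {S. S \<subseteq> I \<and> 2 \<le> card S \<and> card S \<le> k + 2}"
  define high where "high = {S. S \<subseteq> I \<and> k + 3 \<le> card S}"
  define N where "N M = E (\<lambda>w. (partial_set a b M \<phi> w)\<^sup>2)" for M
  define r where "r = (p * (1 - p))\<^sup>2"
  have fin: "finite pairs" "finite low" "finite high"
    using finite_I by (auto simp: pairs_def low_def high_def)
  have r0: "r \<ge> 0" by (simp add: r_def)
  have sub: "{M \<in> pairs. M \<subseteq> S} = {M. M \<subseteq> S \<and> card M = 2}" if "S \<subseteq> I" for S
    using that by (auto simp: pairs_def)
  have finS: "finite S" if "S \<subseteq> I" for S using that finite_I finite_subset by blast
  have card_sub: "card {M \<in> pairs. M \<subseteq> S} = card S choose 2" if "S \<subseteq> I" for S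
    unfolding sub[OF that] using finS[OF that] by (rule n_subsets)

  have "(\<Sum>S\<in>low. (coeff \<phi> S)\<^sup>2) \<le> (\<Sum>S\<in>low. \<Sum>M | M \<in> pairs \<and> M \<subseteq> S. (coeff \<phi> S)\<^sup>2)"
  proof (rule sum_mono)
    fix S assume S: "S \<in> low"
    have "card S choose 2 \<ge> 1" using S by (simp add: low_def Suc_le_eq zero_less_binomial_iff)
    hence "1 * (coeff \<phi> S)\<^sup>2 \<le> real (card S choose 2) * (coeff \<phi> S)\<^sup>2"
      by (intro mult_right_mono) auto
    thus "(coeff \<phi> S)\<^sup>2 \<le> (\<Sum>M | M \<in> pairs \<and> M \<subseteq> S. (coeff \<phi> S)\<^sup>2)"
      using S card_sub[of S] by (simp add: low_def)
  qed
  also have "\<dots> = (\<Sum>M\<in>pairs. \<Sum>S | S \<in> low \<and> M \<subseteq> S. (coeff \<phi> S)\<^sup>2)"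
    using fin by (intro sum.swap_restrict) auto
  also have "\<dots> \<le> (\<Sum>M\<in>pairs. r * (N M * sqrt q * B ^ k))"
  proof (rule sum_mono)
    fix M assume M: "M \<in> pairs"
    have q': "E (\<lambda>w. of_bool (partial_set a b M \<phi> w \<noteq> 0)) \<le> q"
      using q M by (auto simp: pairs_def)
    have "(\<Sum>S | S \<in> low \<and> M \<subseteq> S. (coeff \<phi> S)\<^sup>2) = r *
        (\<Sum>R\<in>(\<lambda>S. S - M) ` {S. S \<in> low \<and> M \<subseteq> S}. (coeff (partial_set a b M \<phi>) R)\<^sup>2)"
      unfolding r_def using M by (intro sum_coeff_pair) (auto simp: low_def pairs_def)
    also have "\<dots> \<le> r * (\<Sum>R | R \<subseteq> I \<and> card R \<le> k. (coeff (partial_set a b M \<phi>) R)\<^sup>2)"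
    proof (intro mult_left_mono sum_mono2 r0)
      show "(\<lambda>S. S - M) ` {S. S \<in> low \<and> M \<subseteq> S} \<subseteq> {R. R \<subseteq> I \<and> card R \<le> k}"
      proof safe
        fix S assume S: "S \<in> low" "M \<subseteq> S"
        have "card (S - M) = card S - card M"
          using S finS M by (intro card_Diff_subset) (auto simp: pairs_def)
        thus "card (S - M) \<le> k" using S M by (auto simp: low_def pairs_def)
      qed (auto simp: low_def)
    qed (use finite_I in auto)
    also have "\<dots> \<le> r * (N M * sqrt (E (\<lambda>w. of_bool (partial_set a b M \<phi> w \<noteq> 0))) * B ^ k)"
      unfolding N_def by (intro mult_left_mono r0 level_inequality B)
    also have "\<dots> \<le> r * (N M * sqrt q * B ^ k)"
      using B q' by (intro mult_left_mono mult_right_mono r0) (auto simp: N_def)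
    finally show "(\<Sum>S | S \<in> low \<and> M \<subseteq> S. (coeff \<phi> S)\<^sup>2) \<le> r * (N M * sqrt q * B ^ k)" .
  qed
  finally have low: "(\<Sum>S\<in>low. (coeff \<phi> S)\<^sup>2) \<le> r * (sqrt q * B ^ k) * (\<Sum>M\<in>pairs. N M)"
    by (simp add: sum_distrib_left sum_distrib_right mult_ac)

  have "(\<Sum>S\<in>high. (real k + 1)\<^sup>2 / 2 * (coeff \<phi> S)\<^sup>2) \<le>
      (\<Sum>S\<in>high. \<Sum>M | M \<in> pairs \<and> M \<subseteq> S. (coeff \<phi> S)\<^sup>2)"
  proof (rule sum_mono)
    fix S assume S: "S \<in> high"
    hence c: "card S \<ge> k + 3" by (simp add: high_def)
    have "real (k + 3) * real (k + 2) \<le> real (card S) * real (card S - 1)"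
      using c by (intro mult_mono) auto
    moreover have "(real k + 1)\<^sup>2 \<le> real (k + 3) * real (k + 2)"
      by (simp add: power2_eq_square algebra_simps)
    moreover have "real (card S choose 2) = real (card S) * real (card S - 1) / 2"
      by (rule of_nat_choose_two)
    ultimately have "(real k + 1)\<^sup>2 / 2 \<le> real (card S choose 2)" by linarith
    hence "(real k + 1)\<^sup>2 / 2 * (coeff \<phi> S)\<^sup>2 \<le> real (card S choose 2) * (coeff \<phi> S)\<^sup>2"
      by (intro mult_right_mono) auto
    thus "(real k + 1)\<^sup>2 / 2 * (coeff \<phi> S)\<^sup>2 \<le> (\<Sum>M | M \<in> pairs \<and> M \<subseteq> S. (coeff \<phi> S)\<^sup>2)"
      using S card_sub[of S] by (simp add: high_def)
  qed
  also have "\<dots> = (\<Sum>M\<in>pairs. \<Sum>S | S \<in> high \<and> M \<subseteq> S. (coeff \<phi> S)\<^sup>2)"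
    using fin by (intro sum.swap_restrict) auto
  also have "\<dots> \<le> (\<Sum>M\<in>pairs. r * N M)"
  proof (rule sum_mono)
    fix M assume M: "M \<in> pairs"
    have "(\<Sum>S | S \<in> high \<and> M \<subseteq> S. (coeff \<phi> S)\<^sup>2) = r *
        (\<Sum>R\<in>(\<lambda>S. S - M) ` {S. S \<in> high \<and> M \<subseteq> S}. (coeff (partial_set a b M \<phi>) R)\<^sup>2)"
      unfolding r_def using M by (intro sum_coeff_pair) (auto simp: high_def pairs_def)
    also have "\<dots> \<le> r * (\<Sum>R\<in>Pow I. (coeff (partial_set a b M \<phi>) R)\<^sup>2)"
      using finite_I by (intro mult_left_mono sum_mono2 r0) (auto simp: high_def)
    also have "\<dots> = r * N M" by (simp add: N_def parseval)
    finally show "(\<Sum>S | S \<in> high \<and> M \<subseteq> S. (coeff \<phi> S)\<^sup>2) \<le> r * N M" .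
  qed
  finally have "(real k + 1)\<^sup>2 / 2 * (\<Sum>S\<in>high. (coeff \<phi> S)\<^sup>2) \<le> r * (\<Sum>M\<in>pairs. N M)"
    by (simp add: sum_distrib_left)
  hence high: "(\<Sum>S\<in>high. (coeff \<phi> S)\<^sup>2) \<le> r * (2 / (real k + 1)\<^sup>2) * (\<Sum>M\<in>pairs. N M)"
    by (simp add: field_simps)

  have "{S. S \<subseteq> I \<and> 2 \<le> card S} = low \<union> high" by (auto simp: low_def high_def)
  moreover have "low \<inter> high = {}" by (auto simp: low_def high_def)
  ultimately have "(\<Sum>S | S \<subseteq> I \<and> 2 \<le> card S. (coeff \<phi> S)\<^sup>2) =
      (\<Sum>S\<in>low. (coeff \<phi> S)\<^sup>2) + (\<Sum>S\<in>high. (coeff \<phi> S)\<^sup>2)"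
    using fin by (simp add: sum.union_disjoint)
  also have "\<dots> \<le> r * (2 / (real k + 1)\<^sup>2 + sqrt q * B ^ k) * (\<Sum>M\<in>pairs. N M)"
    using add_mono[OF high low] by (simp add: distrib_left distrib_right add.commute)
  finally show ?thesis unfolding r_def N_def pairs_def .
qed

text \<open>The Parseval identity, with the coefficients of the singletons written as mean derivatives.\<close>

lemma variance_level_split:
  "measure_pmf.variance law \<phi> = p * (1 - p) * (\<Sum>i\<in>I. (E (partial a b i \<phi>))\<^sup>2) +
    (\<Sum>S | S \<subseteq> I \<and> 2 \<le> card S. (coeff \<phi> S)\<^sup>2)"
proof -
  have empty: "coeff \<phi> {} = E \<phi>" by (simp add: coeff_def)
  have single: "(\<Sum>S\<in>(\<lambda>i. {i}) ` I. (coeff \<phi> S)\<^sup>2) =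
      p * (1 - p) * (\<Sum>i\<in>I. (E (partial a b i \<phi>))\<^sup>2)"
    using p coeff_insert[of _ "{}" \<phi>]
    by (simp add: sum.reindex sum_distrib_left power_mult_distrib) (simp add: coeff_def)
  have "S = {} \<or> S \<in> (\<lambda>i. {i}) ` I \<or> 2 \<le> card S" if "S \<subseteq> I" for S
  proof -
    have "finite S" using that finite_I finite_subset by blast
    moreover consider "card S = 0" | "card S = 1" | "2 \<le> card S" by linarith
    ultimately show ?thesis using that by cases (auto simp: card_1_singleton_iff)
  qed
  hence "Pow I = insert {} ((\<lambda>i. {i}) ` I \<union> {S. S \<subseteq> I \<and> 2 \<le> card S})" by auto
  moreover have "(\<lambda>i. {i}) ` I \<inter> {S. S \<subseteq> I \<and> 2 \<le> card S} = {}" by auto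
  ultimately have "(\<Sum>S\<in>Pow I. (coeff \<phi> S)\<^sup>2) = (E \<phi>)\<^sup>2 +
      (p * (1 - p) * (\<Sum>i\<in>I. (E (partial a b i \<phi>))\<^sup>2) +
        (\<Sum>S | S \<subseteq> I \<and> 2 \<le> card S. (coeff \<phi> S)\<^sup>2))"
    using finite_I by (simp add: sum.union_disjoint single empty image_iff)
  thus ?thesis
    by (subst measure_pmf.variance_eq) (simp_all add: parseval)
qed

text \<open>A second derivative is a difference of two values of \<open>partial a b j \<phi>\<close> with the edge \<open>i\<close> fixed, and fixing
  an edge raises the probability of an event by at most the inverse probability of its value.\<close>

lemma prob_partial_pair_le:
  assumes "i \<in> I" "i \<noteq> j"
  shows "E (\<lambda>w. of_bool (partial_set a b {i, j} \<phi> w \<noteq> 0)) \<le>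
    (1 / p + 1 / (1 - p)) * E (\<lambda>w. of_bool (partial a b j \<phi> w \<noteq> 0))"
proof -
  define \<psi> :: "config \<Rightarrow> real" where "\<psi> = (\<lambda>w. of_bool (partial a b j \<phi> w \<noteq> 0))"
  have "E (\<lambda>w. of_bool (partial_set a b {i, j} \<phi> w \<noteq> 0)) \<le>
      E (\<lambda>w. \<psi> (w(i := a)) + \<psi> (w(i := b)))"
    using assms(2)
    by (intro E_mono) (auto simp: partial_set_pair partial_def[of a b i] subst_edge_def \<psi>_def)
  also have "\<dots> = E (\<lambda>w. \<psi> (w(i := a))) + E (\<lambda>w. \<psi> (w(i := b)))" by simp
  also have "\<dots> \<le> 1 / p * E \<psi> + 1 / (1 - p) * E \<psi>"
    using E_upd_le[OF assms(1), of \<psi>] p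
    by (intro add_mono) (simp_all add: \<psi>_def field_simps)
  finally show ?thesis by (simp add: \<psi>_def distrib_right)
qed

end

section \<open>Geodesics and derivatives of the passage time\<close>

lemma torus_time_le: "\<gamma> \<in> admissible_paths d n \<Longrightarrow> torus_time d n w \<le> path_time n \<gamma> w"
  unfolding torus_time_def by (rule Min_le) (auto simp: finite_admissible_paths)

lemma geodesic_exists:
  assumes "d \<ge> 1" "n \<ge> 1"
  shows "\<exists>\<gamma>\<in>admissible_paths d n. path_time n \<gamma> w = torus_time d n w"
  using Min_in[of "(\<lambda>\<gamma>. path_time n \<gamma> w) ` admissible_paths d n"]
    finite_admissible_paths admissible_paths_nonempty[OF assms]
  unfolding torus_time_def by fastforce

lemma finite_path_edges: "finite (path_edges n \<gamma>)"
  by (cases \<gamma>) (simp add: path_edges_def)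

lemma path_edges_subset:
  assumes "\<gamma> \<in> admissible_paths d n"
  shows "path_edges n \<gamma> \<subseteq> torus_edges d n"
  using assms walk_edges_in_torus_edges
  by (cases \<gamma>) (auto simp: path_edges_def admissible_paths_def simple_closed_path_def)

lemma path_time_upd:
  "path_time n \<gamma> (w(j := y)) = path_time n \<gamma> (w(j := x)) + of_bool (j \<in> path_edges n \<gamma>) * (y - x)"
proof (cases "j \<in> path_edges n \<gamma>")
  case True
  hence "path_time n \<gamma> (w(j := z)) = z + (\<Sum>e\<in>path_edges n \<gamma> - {j}. w e)" for z
    unfolding path_time_def using finite_path_edges by (subst sum.remove[of _ j]) auto
  thus ?thesis using True by simp
next
  case False
  hence "path_time n \<gamma> (w(j := z)) = (\<Sum>e\<in>path_edges n \<gamma>. w e)" for z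
    unfolding path_time_def by (intro sum.cong) auto
  thus ?thesis using False by simp
qed

lemma partial_torus_time_bounds:
  assumes "d \<ge> 1" "n \<ge> 1" "a < b"
  shows "0 \<le> partial a b j (torus_time d n) w" "partial a b j (torus_time d n) w \<le> b - a"
proof -
  have upd: "path_time n \<gamma> (w(j := a)) \<le> path_time n \<gamma> (w(j := b))"
    "path_time n \<gamma> (w(j := b)) \<le> path_time n \<gamma> (w(j := a)) + (b - a)" for \<gamma>
    using assms(3) by (auto simp: path_time_upd[of n \<gamma> w j b a])
  obtain \<gamma> where "\<gamma> \<in> admissible_paths d n"
    "path_time n \<gamma> (w(j := b)) = torus_time d n (w(j := b))"
    using geodesic_exists[OF assms(1,2)] by blast
  thus "0 \<le> partial a b j (torus_time d n) w"
    using torus_time_le[of \<gamma> d n "w(j := a)"] upd(1)[of \<gamma>]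
    by (simp add: partial_def subst_edge_def)
  obtain \<delta> where "\<delta> \<in> admissible_paths d n"
    "path_time n \<delta> (w(j := a)) = torus_time d n (w(j := a))"
    using geodesic_exists[OF assms(1,2)] by blast
  thus "partial a b j (torus_time d n) w \<le> b - a"
    using torus_time_le[of \<delta> d n "w(j := b)"] upd(2)[of \<delta>]
    by (simp add: partial_def subst_edge_def)
qed

text \<open>A geodesic avoiding \<open>j\<close> keeps its passage time when \<open>j\<close> becomes expensive, so the minimum
  could not increase.\<close>

lemma pivotal_on_geodesic:
  assumes "d \<ge> 1" "n \<ge> 1" "a < b" "partial a b j (torus_time d n) w \<noteq> 0" "w j = a"
    and "\<gamma> \<in> admissible_paths d n" "path_time n \<gamma> w = torus_time d n w"
  shows "j \<in> path_edges n \<gamma>"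
proof (rule ccontr)
  assume "j \<notin> path_edges n \<gamma>"
  hence "path_time n \<gamma> (w(j := b)) = path_time n \<gamma> (w(j := a))"
    using path_time_upd[of n \<gamma> w j b a] by simp
  moreover have "w(j := a) = w" using assms(5) by auto
  ultimately have "torus_time d n (w(j := b)) \<le> torus_time d n (w(j := a))"
    using torus_time_le[OF assms(6), of "w(j := b)"] assms(7) by simp
  thus False
    using assms(4) partial_torus_time_bounds(1)[OF assms(1-3), of j w]
    by (simp add: partial_def subst_edge_def)
qed

text \<open>The straight line in the first direction bounds the passage time from above by \<open>n b\<close>, and thereby
  the number of edges of a geodesic.\<close>

lemma straight_path_admissible:
  assumes "d \<ge> 1" "n \<ge> 1"
  shows "((\<lambda>k\<in>{1..d}. 0), replicate n (1, 1)) \<in> admissible_paths d n"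
proof -
  define x :: vertex where "x = (\<lambda>k\<in>{1..d}. 0)"
  define v where "v i = (if i = 0 then x else torus_shift n x 1 (int i))" for i
  have coord: "v i 1 = int i" if "i < n" for i
    using that assms by (simp add: v_def x_def torus_shift_def)
  have inj: "inj_on v {0..<n}"
    by (rule inj_onI) (metis coord atLeastLessThan_iff of_nat_eq_iff)
  have closed: "v n = x"
    using assms by (auto simp: v_def x_def torus_shift_def fun_eq_iff)
  have vertices: "walk_vertices n x (replicate n (1, 1)) = map v [0..<n] @ [x]"
    using closed walk_straight(1)[of n x n 1, folded v_def] by simp
  have edges: "walk_edges n x (replicate n (1, 1)) = map (\<lambda>i. (v i, 1)) [0..<n]"
    by (simp add: walk_straight(2) v_def)
  have "inj_on (\<lambda>i. (v i, 1::nat)) {0..<n}" using inj by (auto simp: inj_on_def)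
  moreover have "x \<in> torus_vertices d n" using assms by (auto simp: x_def torus_vertices_def)
  ultimately have "simple_closed_path d n (x, replicate n (1, 1))"
    unfolding simple_closed_path_def prod.case vertices edges
    using assms inj by (auto simp: distinct_map)
  moreover have "count_list (replicate m c) c' = (if c = c' then m else 0)"
    for m and c c' :: "nat \<times> int"
    by (induction m) auto
  hence "net_steps1 (x, replicate n (1, 1)) = int n" by (simp add: net_steps1_def)
  ultimately show ?thesis by (simp add: admissible_paths_def x_def)
qed

lemma torus_time_le_straight:
  assumes "d \<ge> 1" "n \<ge> 1" "\<And>e. e \<in> torus_edges d n \<Longrightarrow> w e \<le> b" "0 \<le> b"
  shows "torus_time d n w \<le> real n * b"
proof -
  define x :: vertex where "x = (\<lambda>k\<in>{1..d}. 0)"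
  define \<gamma> :: path where "\<gamma> = (x, replicate n (1, 1))"
  have \<gamma>: "\<gamma> \<in> admissible_paths d n"
    unfolding \<gamma>_def x_def by (rule straight_path_admissible[OF assms(1,2)])
  have "torus_time d n w \<le> path_time n \<gamma> w" by (rule torus_time_le[OF \<gamma>])
  also have "\<dots> \<le> real (card (path_edges n \<gamma>)) * b"
    unfolding path_time_def
    using path_edges_subset[OF \<gamma>] assms(3) by (intro sum_bounded_above) auto
  also have "card (path_edges n \<gamma>) \<le> n"
    using card_length[of "walk_edges n x (replicate n (1, 1))"]
    by (simp add: path_edges_def \<gamma>_def length_walk_edges)
  hence "real (card (path_edges n \<gamma>)) * b \<le> real n * b"
    using assms(4) by (intro mult_right_mono) auto
  finally show ?thesis .
qed


section \<open>Translation invariance\<close>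

definition translate_vertex :: "nat \<Rightarrow> nat \<Rightarrow> vertex \<Rightarrow> vertex \<Rightarrow> vertex" where
  "translate_vertex d n y x = (\<lambda>k\<in>{1..d}. (x k + y k) mod int n)"

text \<open>Off the torus the map is the identity, which makes it injective on the whole type: composing
  configurations with it then commutes with updates and preserves the default value off the torus.\<close>

definition translate_edge :: "nat \<Rightarrow> nat \<Rightarrow> vertex \<Rightarrow> edge \<Rightarrow> edge" where
  "translate_edge d n y e =
     (if e \<in> torus_edges d n then (translate_vertex d n y (fst e), snd e) else e)"

lemma translate_vertex_in:
  assumes "n \<ge> 1"
  shows "translate_vertex d n y x \<in> torus_vertices d n"
  using assms by (auto simp: translate_vertex_def torus_vertices_def)

lemma inj_on_translate_vertex: "inj_on (translate_vertex d n y) (torus_vertices d n)"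
proof (rule inj_onI)
  fix x x' assume x: "x \<in> torus_vertices d n" "x' \<in> torus_vertices d n"
    and eq: "translate_vertex d n y x = translate_vertex d n y x'"
  show "x = x'"
  proof (rule PiE_ext[OF x[unfolded torus_vertices_def]])
    fix k assume k: "k \<in> {1..d}"
    have "(x k + y k) mod int n = (x' k + y k) mod int n"
      using fun_cong[OF eq, of k] k by (simp add: translate_vertex_def)
    hence "(x k + y k - y k) mod int n = (x' k + y k - y k) mod int n"
      by (metis mod_diff_left_eq)
    moreover have "x k \<in> {0..<int n}" "x' k \<in> {0..<int n}"
      using x k unfolding torus_vertices_def by (blast dest: PiE_mem)+
    ultimately show "x k = x' k" by simp
  qed
qed

lemma translate_vertex_shift:
  assumes "k \<in> {1..d}"
  shows "translate_vertex d n y (torus_shift n x k s) = torus_shift n (translate_vertex d n y x) k s"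
  using assms by (auto simp: translate_vertex_def torus_shift_def fun_eq_iff mod_simps algebra_simps)

lemma walk_vertices_translate:
  "set ss \<subseteq> {1..d} \<times> {1, -1} \<Longrightarrow>
   walk_vertices n (translate_vertex d n y x) ss = map (translate_vertex d n y) (walk_vertices n x ss)"
  by (induction n x ss rule: walk_vertices.induct) (auto simp flip: translate_vertex_shift)

lemma walk_edges_translate:
  assumes "x \<in> torus_vertices d n" "set ss \<subseteq> {1..d} \<times> {1, -1}"
  shows "walk_edges n (translate_vertex d n y x) ss = map (translate_edge d n y) (walk_edges n x ss)"
  using assms
proof (induction n x ss rule: walk_edges.induct)
  case (2 n x k s ss)
  hence "torus_shift n x k s \<in> torus_vertices d n" by (auto intro: torus_shift_in_torus_vertices)
  thus ?case using 2
    by (auto simp: translate_edge_def torus_edges_def simp flip: translate_vertex_shift)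
qed simp

lemma walk_vertices_in_torus_vertices:
  "x \<in> torus_vertices d n \<Longrightarrow> set ss \<subseteq> {1..d} \<times> {1, -1} \<Longrightarrow>
   set (walk_vertices n x ss) \<subseteq> torus_vertices d n"
  by (induction n x ss rule: walk_vertices.induct) (auto simp: torus_shift_in_torus_vertices)

lemma bij_betw_translate_edge:
  assumes "n \<ge> 1"
  shows "bij_betw (translate_edge d n y) (torus_edges d n) (torus_edges d n)"
proof -
  have "inj_on (translate_edge d n y) (torus_edges d n)"
    using inj_on_translate_vertex[of d n y]
    by (auto simp: inj_on_def translate_edge_def torus_edges_def)
  moreover have "translate_edge d n y ` torus_edges d n \<subseteq> torus_edges d n"
    using translate_vertex_in[OF assms] by (auto simp: translate_edge_def torus_edges_def)
  ultimately show ?thesis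
    using endo_inj_surj[OF finite_torus_edges] by (auto simp: bij_betw_def)
qed

lemma inj_translate_edge:
  assumes "n \<ge> 1"
  shows "inj (translate_edge d n y)"
proof (rule injI)
  fix e e' assume eq: "translate_edge d n y e = translate_edge d n y e'"
  note bij = bij_betw_translate_edge[OF assms, of d y]
  have "translate_edge d n y f \<in> torus_edges d n \<longleftrightarrow> f \<in> torus_edges d n" for f
    using bij_betw_apply[OF bij, of f] by (auto simp: translate_edge_def)
  with eq have "e \<in> torus_edges d n \<longleftrightarrow> e' \<in> torus_edges d n" by metis
  thus "e = e'"
    using eq bij by (cases "e \<in> torus_edges d n") (auto simp: bij_betw_def inj_on_def translate_edge_def)
qed

text \<open>Translation maps the finite set of admissible paths injectively into itself, hence onto itself.\<close>

lemma admissible_paths_translate: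
  assumes "n \<ge> 1"
  shows "map_prod (translate_vertex d n y) id ` admissible_paths d n = admissible_paths d n"
proof (rule endo_inj_surj[OF finite_admissible_paths])
  show "map_prod (translate_vertex d n y) id ` admissible_paths d n \<subseteq> admissible_paths d n"
  proof (rule image_subsetI)
    fix \<gamma> assume "\<gamma> \<in> admissible_paths d n"
    moreover obtain x ss where \<gamma>: "\<gamma> = (x, ss)" by (cases \<gamma>)
    ultimately have path: "x \<in> torus_vertices d n" "set ss \<subseteq> {1..d} \<times> {1, -1}"
        "last (walk_vertices n x ss) = x" "distinct (butlast (walk_vertices n x ss))"
        "distinct (walk_edges n x ss)" and net: "\<bar>net_steps1 (x, ss)\<bar> = int n"
      by (auto simp: admissible_paths_def simple_closed_path_def)
    have ne: "walk_vertices n x ss \<noteq> []" by (cases ss) auto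
    have "inj_on (translate_vertex d n y) (set (butlast (walk_vertices n x ss)))"
      using inj_on_translate_vertex walk_vertices_in_torus_vertices[OF path(1,2)]
      by (meson in_set_butlastD inj_on_subset subset_iff)
    moreover have "inj_on (translate_edge d n y) (set (walk_edges n x ss))"
      using inj_translate_edge[OF assms] inj_on_subset by blast
    ultimately have "simple_closed_path d n (translate_vertex d n y x, ss)"
      using path ne translate_vertex_in[OF assms, of d y x]
      by (simp add: simple_closed_path_def walk_vertices_translate walk_edges_translate
          last_map distinct_map flip: map_butlast)
    thus "map_prod (translate_vertex d n y) id \<gamma> \<in> admissible_paths d n"
      using net by (simp add: \<gamma> admissible_paths_def net_steps1_def)
  qed
  show "inj_on (map_prod (translate_vertex d n y) id) (admissible_paths d n)"
    using inj_on_translate_vertex[of d n y]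
    by (auto simp: inj_on_def admissible_paths_def simple_closed_path_def)
qed

lemma path_time_translate:
  assumes "n \<ge> 1" "\<gamma> \<in> admissible_paths d n"
  shows "path_time n (map_prod (translate_vertex d n y) id \<gamma>) w = path_time n \<gamma> (w \<circ> translate_edge d n y)"
proof -
  obtain x ss where \<gamma>: "\<gamma> = (x, ss)" by (cases \<gamma>)
  have "path_edges n (map_prod (translate_vertex d n y) id \<gamma>) = translate_edge d n y ` path_edges n \<gamma>"
    using assms(2) walk_edges_translate[of x d n ss y]
    by (simp add: \<gamma> path_edges_def admissible_paths_def simple_closed_path_def)
  moreover have "inj_on (translate_edge d n y) (path_edges n \<gamma>)"
    using inj_translate_edge[OF assms(1)] inj_on_subset by blast
  ultimately show ?thesis by (simp add: path_time_def sum.reindex)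
qed

lemma torus_time_translate:
  assumes "n \<ge> 1"
  shows "torus_time d n (w \<circ> translate_edge d n y) = torus_time d n w"
proof -
  have "(\<lambda>\<gamma>. path_time n \<gamma> (w \<circ> translate_edge d n y)) ` admissible_paths d n =
      (\<lambda>\<gamma>. path_time n \<gamma> w) ` map_prod (translate_vertex d n y) id ` admissible_paths d n"
    unfolding image_image using path_time_translate[OF assms] by (intro image_cong) auto
  thus ?thesis by (simp add: torus_time_def admissible_paths_translate[OF assms])
qed

lemma partial_torus_time_translate:
  assumes "n \<ge> 1"
  shows "partial a b j (torus_time d n) (w \<circ> translate_edge d n y) =
    partial a b (translate_edge d n y j) (torus_time d n) w"
proof -
  have "(w \<circ> translate_edge d n y)(j := x) = w(translate_edge d n y j := x) \<circ> translate_edge d n y" for x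
    by (rule ext) (simp add: inj_eq[OF inj_translate_edge[OF assms]])
  thus ?thesis using assms by (simp add: partial_def subst_edge_def torus_time_translate)
qed

lemma ex_translate_vertex:
  assumes "x \<in> torus_vertices d n" "x' \<in> torus_vertices d n"
  shows "\<exists>y. translate_vertex d n y x = x'"
proof
  \<comment> \<open>The difference need not be reduced: translating reduces modulo \<open>n\<close>.\<close>
  show "translate_vertex d n (\<lambda>k. x' k - x k) x = x'"
  proof (rule PiE_ext[of _ "{1..d}" "\<lambda>_. UNIV"])
    fix k assume "k \<in> {1..d}"
    moreover from this have "x' k \<in> {0..<int n}"
      using assms(2) unfolding torus_vertices_def by (blast dest: PiE_mem)
    ultimately show "translate_vertex d n (\<lambda>k. x' k - x k) x k = x' k"
      by (simp add: translate_vertex_def)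
  qed (use assms in \<open>auto simp: translate_vertex_def torus_vertices_def PiE_iff\<close>)
qed

section \<open>Influences in the torus\<close>

locale torus = biased_cube "torus_edges d n" a b p for d n :: nat and a b p :: real +
  assumes d: "d \<ge> 1" and n: "n \<ge> 1" and a: "0 < a"
begin

definition influence :: "edge \<Rightarrow> real" where
  "influence j = E (\<lambda>w. of_bool (partial a b j (torus_time d n) w \<noteq> 0))"

lemma influence_nonneg: "0 \<le> influence j"
  unfolding influence_def by (rule E_nonneg) simp

lemma torus_pmf_law: "torus_pmf d n a b p = law"
  by (simp add: torus_pmf_def law_def)

text \<open>Fix a geodesic \<open>G w\<close> for every configuration. The derivative at \<open>j\<close> does not depend on the value of \<open>j\<close>, so
  it is nonzero while \<open>j\<close> is cheap with probability \<open>p\<close> times the influence, and then \<open>j\<close> lies on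
  \<open>G w\<close>. Summing over \<open>j\<close> bounds the total influence by \<open>1 / p\<close> times the mean length of \<open>G w\<close>.\<close>

lemma sum_influence_le: "(\<Sum>j\<in>torus_edges d n. influence j) \<le> b / (a * p) * real n"
proof -
  define G where "G w = (SOME \<gamma>. \<gamma> \<in> admissible_paths d n \<and> path_time n \<gamma> w = torus_time d n w)" for w
  have G: "G w \<in> admissible_paths d n" "path_time n (G w) w = torus_time d n w" for w
    using someI_ex[of "\<lambda>\<gamma>. \<gamma> \<in> admissible_paths d n \<and> path_time n \<gamma> w = torus_time d n w"]
      geodesic_exists[OF d n, of w] by (auto simp: G_def)
  have "p * influence j \<le> E (\<lambda>w. of_bool (j \<in> path_edges n (G w)))" if j: "j \<in> torus_edges d n" for j
  proof -
    have "p * influence j =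
        E (\<lambda>w. of_bool (w j = a) * of_bool (partial a b j (torus_time d n) w \<noteq> 0))"
      using ab by (subst E_edge_times[OF j, where g = "\<lambda>x. of_bool (x = a)"]) (auto simp: influence_def)
    also have "\<dots> \<le> E (\<lambda>w. of_bool (j \<in> path_edges n (G w)))"
      using pivotal_on_geodesic[OF d n ab _ _ G] by (intro E_mono) (auto simp: of_bool_def)
    finally show ?thesis .
  qed
  hence "(\<Sum>j\<in>torus_edges d n. p * influence j) \<le>
      (\<Sum>j\<in>torus_edges d n. E (\<lambda>w. of_bool (j \<in> path_edges n (G w))))"
    by (rule sum_mono)
  also have "\<dots> = E (\<lambda>w. real (card (path_edges n (G w))))"
  proof -
    have "(\<Sum>j\<in>torus_edges d n. of_bool (j \<in> path_edges n (G w))) = real (card (path_edges n (G w)))" for w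
      using path_edges_subset[OF G(1)[of w]] finite_torus_edges
      by (subst sum_of_bool_eq) (auto simp: Int_absorb1 intro!: arg_cong[of _ _ card])
    thus ?thesis by (subst Bochner_Integration.integral_sum[symmetric]) simp_all
  qed
  also have "\<dots> \<le> E (\<lambda>w. b / a * real n)"
  proof (rule E_mono)
    fix w assume w: "w \<in> set_pmf law"
    have "real (card (path_edges n (G w))) * a \<le> path_time n (G w) w"
      unfolding path_time_def using path_edges_subset[OF G(1)[of w]] law_edge[OF w] ab
      by (intro sum_bounded_below) force
    also have "\<dots> \<le> real n * b"
      unfolding G(2) using law_edge[OF w] ab a by (intro torus_time_le_straight d n) force+
    finally show "real (card (path_edges n (G w))) \<le> b / a * real n"
      using a by (simp add: field_simps)
  qed
  finally have "p * (\<Sum>j\<in>torus_edges d n. influence j) \<le> b / a * real n"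
    by (simp add: sum_distrib_left)
  thus ?thesis using a p by (simp add: field_simps)
qed

lemma influence_translate:
  assumes "x \<in> torus_vertices d n" "x' \<in> torus_vertices d n" "k \<in> {1..d}"
  shows "influence (x, k) = influence (x', k)"
proof -
  obtain y where y: "translate_vertex d n y x = x'" using ex_translate_vertex[OF assms(1,2)] by blast
  let ?t = "translate_edge d n y"
  have edge: "?t (x, k) = (x', k)" using assms y by (simp add: translate_edge_def torus_edges_def)
  have "law = map_pmf (\<lambda>w. w \<circ> ?t) law"
    unfolding law_def
    by (rule Pi_pmf_bij_betw[OF finite_torus_edges bij_betw_translate_edge[OF n]])
      (simp add: translate_edge_def)
  hence "influence (x, k) = measure_pmf.expectation (map_pmf (\<lambda>w. w \<circ> ?t) law)
      (\<lambda>w. of_bool (partial a b (x, k) (torus_time d n) w \<noteq> 0))"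
    unfolding influence_def by simp
  also have "\<dots> = influence (x', k)"
    by (simp add: partial_torus_time_translate[OF n] edge influence_def)
  finally show ?thesis .
qed

text \<open>The \<open>n ^ d\<close> edges parallel to \<open>j\<close> have the same influence, and together at most a multiple of \<open>n\<close>.\<close>

lemma influence_le:
  assumes "d \<ge> 2" "j \<in> torus_edges d n"
  shows "influence j \<le> b / (a * p) / real n"
proof -
  obtain x k where j: "j = (x, k)" "x \<in> torus_vertices d n" "k \<in> {1..d}"
    using assms(2) by (auto simp: torus_edges_def)
  have fin: "finite (torus_vertices d n)" by (simp add: torus_vertices_def finite_PiE)
  have "real n * real n * influence j \<le> real n ^ d * influence j"
  proof -
    have "real n ^ 2 \<le> real n ^ d" using assms n by (intro power_increasing) auto
    thus ?thesis using influence_nonneg by (intro mult_right_mono) (auto simp: power2_eq_square)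
  qed
  also have "\<dots> = (\<Sum>x'\<in>torus_vertices d n. influence (x', k))"
  proof -
    have "(\<Sum>x'\<in>torus_vertices d n. influence (x', k)) = (\<Sum>x'\<in>torus_vertices d n. influence j)"
      unfolding j(1) using influence_translate[OF j(2) _ j(3)] by (intro sum.cong refl) metis
    thus ?thesis by (simp add: torus_vertices_def card_PiE)
  qed
  also have "\<dots> = (\<Sum>e\<in>(\<lambda>x'. (x', k)) ` torus_vertices d n. influence e)"
    by (subst sum.reindex) (auto simp: inj_on_def)
  also have "\<dots> \<le> (\<Sum>e\<in>torus_edges d n. influence e)"
    using j finite_torus_edges influence_nonneg by (intro sum_mono2) (auto simp: torus_edges_def)
  also have "\<dots> \<le> b / (a * p) * real n" by (rule sum_influence_le)
  finally have "real n * (real n * influence j) \<le> real n * (b / (a * p))" by (simp add: mult_ac)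
  hence "real n * influence j \<le> b / (a * p)" using n by (simp only: mult_le_cancel_left_pos of_nat_0_less_iff)
  thus ?thesis using n by (subst pos_le_divide_eq) (auto simp: mult.commute)
qed

text \<open>The sum of the squared influences is at most their maximum times their sum, which is
  \<open>O(1/n)\<close> times \<open>O(n)\<close>.\<close>

lemma level_one_le:
  assumes "d \<ge> 2"
  shows "(\<Sum>j\<in>torus_edges d n. (E (partial a b j (torus_time d n)))\<^sup>2) \<le> ((b - a) * (b / (a * p)))\<^sup>2"
proof -
  define K where "K = b / (a * p)"
  have K: "K \<ge> 0" using a ab p by (simp add: K_def)
  have "(\<Sum>j\<in>torus_edges d n. (E (partial a b j (torus_time d n)))\<^sup>2) \<le>
      (\<Sum>j\<in>torus_edges d n. (b - a)\<^sup>2 * (K / real n * influence j))"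
  proof (rule sum_mono)
    fix j assume j: "j \<in> torus_edges d n"
    have "E (partial a b j (torus_time d n)) \<le>
        E (\<lambda>w. (b - a) * of_bool (partial a b j (torus_time d n) w \<noteq> 0))"
      using partial_torus_time_bounds(2)[OF d n ab] ab by (intro E_mono) (auto simp: of_bool_def)
    also have "\<dots> = (b - a) * influence j" by (simp add: influence_def)
    finally have "(E (partial a b j (torus_time d n)))\<^sup>2 \<le> ((b - a) * influence j)\<^sup>2"
      using partial_torus_time_bounds(1)[OF d n ab] by (intro power_mono E_nonneg)
    also have "\<dots> = (b - a)\<^sup>2 * (influence j * influence j)"
      by (simp only: power_mult_distrib power2_eq_square[of "influence j"])
    also have "\<dots> \<le> (b - a)\<^sup>2 * (K / real n * influence j)"
      using influence_le[OF assms j] influence_nonneg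
      by (intro mult_left_mono mult_right_mono) (auto simp: K_def)
    finally show "(E (partial a b j (torus_time d n)))\<^sup>2 \<le> (b - a)\<^sup>2 * (K / real n * influence j)" .
  qed
  also have "\<dots> = (b - a)\<^sup>2 * (K / real n) * (\<Sum>j\<in>torus_edges d n. influence j)"
    by (simp add: sum_distrib_left mult.assoc)
  also have "\<dots> \<le> (b - a)\<^sup>2 * (K / real n) * (K * real n)"
    using sum_influence_le[folded K_def] K by (intro mult_left_mono) auto
  also have "\<dots> = ((b - a) * K)\<^sup>2" using n by (simp add: power_mult_distrib power2_eq_square)
  finally show ?thesis by (simp add: K_def)
qed

lemma prob_partial_pair_torus_le:
  assumes "d \<ge> 2" "M \<subseteq> torus_edges d n" "card M = 2"
  shows "E (\<lambda>w. of_bool (partial_set a b M (torus_time d n) w \<noteq> 0)) \<le>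
    (1 / p + 1 / (1 - p)) * (b / (a * p)) / real n"
proof -
  obtain i j where M: "M = {i, j}" "i \<noteq> j" using assms(3) by (auto simp: card_2_iff)
  have "E (\<lambda>w. of_bool (partial_set a b M (torus_time d n) w \<noteq> 0)) \<le>
      (1 / p + 1 / (1 - p)) * influence j"
    using prob_partial_pair_le[of i j] M assms(2) by (simp add: influence_def)
  also have "\<dots> \<le> (1 / p + 1 / (1 - p)) * (b / (a * p) / real n)"
    using influence_le[OF assms(1), of j] M assms(2) p by (intro mult_left_mono) auto
  finally show ?thesis by simp
qed

lemma num_convoluted_eq:
  "num_convoluted d n a b w =
    card {M. M \<subseteq> torus_edges d n \<and> card M = 2 \<and> partial_set a b M (torus_time d n) w \<noteq> 0}"
proof -
  have "{{i, j} | i j. convoluted d n a b w i j} =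
      {M. M \<subseteq> torus_edges d n \<and> card M = 2 \<and> partial_set a b M (torus_time d n) w \<noteq> 0}"
    (is "?L = ?R")
  proof (intro subset_antisym subsetI)
    fix M assume "M \<in> ?L"
    then obtain i j where "M = {i, j}" "convoluted d n a b w i j" by blast
    thus "M \<in> ?R" by (simp add: convoluted_def partial_set_pair)
  next
    fix M assume M: "M \<in> ?R"
    then obtain i j where ij: "M = {i, j}" "i \<noteq> j" by (auto simp: card_2_iff)
    with M have "convoluted d n a b w i j" by (simp add: convoluted_def partial_set_pair)
    thus "M \<in> ?L" using ij by blast
  qed
  thus ?thesis by (simp add: num_convoluted_def)
qed

lemma sum_pair_norms_le:
  "(\<Sum>M | M \<subseteq> torus_edges d n \<and> card M = 2. E (\<lambda>w. (partial_set a b M (torus_time d n) w)\<^sup>2)) \<le>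
    (b - a)\<^sup>2 * E (\<lambda>w. real (num_convoluted d n a b w))"
proof -
  define pairs where "pairs = {M. M \<subseteq> torus_edges d n \<and> card M = 2}"
  have fin: "finite pairs" using finite_torus_edges by (simp add: pairs_def)
  have "(\<Sum>M\<in>pairs. E (\<lambda>w. (partial_set a b M (torus_time d n) w)\<^sup>2)) =
      E (\<lambda>w. \<Sum>M\<in>pairs. (partial_set a b M (torus_time d n) w)\<^sup>2)"
    by (subst Bochner_Integration.integral_sum) simp_all
  also have "\<dots> \<le> E (\<lambda>w. (b - a)\<^sup>2 * real (num_convoluted d n a b w))"
  proof (rule E_mono)
    fix w
    have "(\<Sum>M\<in>pairs. (partial_set a b M (torus_time d n) w)\<^sup>2) \<le>
        (\<Sum>M\<in>pairs. (b - a)\<^sup>2 * of_bool (partial_set a b M (torus_time d n) w \<noteq> 0))"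
    proof (rule sum_mono)
      fix M assume "M \<in> pairs"
      then obtain i j where M: "M = {i, j}" "i \<noteq> j" by (auto simp: pairs_def card_2_iff)
      \<comment> \<open>The derivative at the pair is a difference of two numbers in \<open>{0..b - a}\<close>.\<close>
    have "\<bar>partial_set a b M (torus_time d n) w\<bar> \<le> b - a"
        using partial_torus_time_bounds[OF d n ab, of j "w(i := a)"]
          partial_torus_time_bounds[OF d n ab, of j "w(i := b)"] M
        by (simp add: partial_set_pair partial_def[of a b i] subst_edge_def abs_le_iff)
      hence "(partial_set a b M (torus_time d n) w)\<^sup>2 \<le> (b - a)\<^sup>2"
        using abs_le_square_iff[of "partial_set a b M (torus_time d n) w" "b - a"] ab by simp
      thus "(partial_set a b M (torus_time d n) w)\<^sup>2 \<le>
          (b - a)\<^sup>2 * of_bool (partial_set a b M (torus_time d n) w \<noteq> 0)" by simp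
    qed
    also have "\<dots> = (b - a)\<^sup>2 * real (card {M \<in> pairs. partial_set a b M (torus_time d n) w \<noteq> 0})"
      using fin by (simp add: Int_def flip: sum_distrib_left)
    finally show "(\<Sum>M\<in>pairs. (partial_set a b M (torus_time d n) w)\<^sup>2) \<le>
        (b - a)\<^sup>2 * real (num_convoluted d n a b w)"
      by (simp add: num_convoluted_eq pairs_def conj_assoc)
  qed
  finally show ?thesis by (simp add: pairs_def)
qed

end

section \<open>The variance bound\<close>

text \<open>The cutoff is the largest \<open>k\<close> with \<open>B ^ k \<le> n powr (1/4)\<close>, which leaves \<open>n powr (-1/4)\<close> of the
  factor \<open>n powr (-1/2)\<close>; this is absorbed by \<open>ln n \<le> 8 * n powr (1/8)\<close>.\<close>

lemma ex_level_cutoff: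
  fixes B Q :: real
  assumes "B \<ge> 4" "Q \<ge> 0" "n \<ge> 2"
  shows "\<exists>k. 2 / (real k + 1)\<^sup>2 + sqrt (Q / real n) * B ^ k \<le>
    (32 * (ln B)\<^sup>2 + 64 * sqrt Q) / (ln (real n))\<^sup>2"
proof -
  define L where "L = ln (real n)"
  define k where "k = nat \<lfloor>L / (4 * ln B)\<rfloor>"
  have L: "L > 0" using assms by (simp add: L_def)
  have lnB: "ln B > 0" using assms by simp
  have k: "real k \<le> L / (4 * ln B)" "L / (4 * ln B) \<le> real k + 1"
    using L lnB by (auto simp: k_def)
  have "2 / (real k + 1)\<^sup>2 \<le> 2 / (L / (4 * ln B))\<^sup>2"
    using k L lnB by (intro divide_left_mono power_mono mult_pos_pos zero_less_power divide_pos_pos) auto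
  also have "\<dots> = 32 * (ln B)\<^sup>2 / L\<^sup>2" by (simp add: power_divide power_mult_distrib)
  finally have 1: "2 / (real k + 1)\<^sup>2 \<le> 32 * (ln B)\<^sup>2 / L\<^sup>2" .
  have "B ^ k = exp (real k * ln B)" using assms by (simp add: exp_of_nat_mult)
  also have "\<dots> \<le> exp (L / 4)" using k(1) lnB by (simp add: field_simps)
  finally have Bk: "B ^ k \<le> exp (L / 4)" .
  have sn: "sqrt (real n) = exp (L / 2)"
    using assms by (intro real_sqrt_unique) (simp_all add: L_def power2_eq_square flip: exp_add)
  have "sqrt (Q / real n) * B ^ k = sqrt Q * (B ^ k / exp (L / 2))"
    by (simp add: real_sqrt_divide sn)
  also have "\<dots> \<le> sqrt Q * (exp (L / 4) / exp (L / 2))"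
    using Bk assms by (intro mult_left_mono divide_right_mono) auto
  also have "exp (L / 4) / exp (L / 2) = 1 / exp (L / 4)"
  proof -
    have "exp (L / 2) = exp (L / 4) * exp (L / 4)" by (simp flip: exp_add)
    thus ?thesis by simp
  qed
  also have "\<dots> \<le> 64 / L\<^sup>2"
  proof -
    have "(L / 8)\<^sup>2 \<le> (exp (L / 8))\<^sup>2"
    proof (rule power_mono)
      show "L / 8 \<le> exp (L / 8)" using exp_ge_add_one_self[of "L / 8"] by linarith
    qed (use L in simp)
    also have "\<dots> = exp (L / 4)" by (simp add: power2_eq_square flip: exp_add)
    finally have "L\<^sup>2 \<le> 64 * exp (L / 4)" by (simp add: power_divide)
    thus ?thesis using L by (simp add: field_simps)
  qed
  finally have 2: "sqrt (Q / real n) * B ^ k \<le> sqrt Q * (64 / L\<^sup>2)"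
    using assms by (simp add: mult_left_mono)
  from add_mono[OF 1 2] show ?thesis
    by (intro exI[of _ k]) (simp add: L_def add_divide_distrib mult.commute)
qed

theorem corollary1:
  fixes d :: nat and a b p :: real
  assumes "d \<ge> 2" and "0 < a" and "a < b" and "0 < p" and "p < 1"
  shows "\<exists>(C::real) (Chat::real) (C'::real) (n0::nat). \<forall>n\<ge>n0.
    measure_pmf.variance (torus_pmf d n a b p) (torus_time d n)
      \<le> C * ((\<Sum>M | M \<subseteq> torus_edges d n \<and> card M = 2.
                 (l2_norm (torus_pmf d n a b p) (partial_set a b M (torus_time d n)))\<^sup>2)
             / (ln (real n))\<^sup>2) + C' \<and>
    C * ((\<Sum>M | M \<subseteq> torus_edges d n \<and> card M = 2.
                 (l2_norm (torus_pmf d n a b p) (partial_set a b M (torus_time d n)))\<^sup>2)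
             / (ln (real n))\<^sup>2) + C'
      \<le> Chat * (measure_pmf.expectation (torus_pmf d n a b p)
                   (\<lambda>\<omega>. real (num_convoluted d n a b \<omega>))
                / (ln (real n))\<^sup>2) + C'"
proof -
  define l where
    "l = 3 * (p * (biased_cube.chi a b p a) ^ 4 + (1 - p) * (biased_cube.chi a b p b) ^ 4)"
  \<comment> \<open>The constants do not depend on \<open>n\<close>: \<open>chi\<close> is a function of \<open>a\<close>, \<open>b\<close> and \<open>p\<close> only.\<close>
  define B where "B = max 4 (sqrt l)"
  define Q where "Q = (1 / p + 1 / (1 - p)) * (b / (a * p))"
  define C where "C = (p * (1 - p))\<^sup>2 * (32 * (ln B)\<^sup>2 + 64 * sqrt Q)"
  define C' where "C' = p * (1 - p) * ((b - a) * (b / (a * p)))\<^sup>2"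
  have l: "l \<ge> 0" using assms by (simp add: l_def)
  have B: "B \<ge> 4" "l \<le> B\<^sup>2"
  proof -
    have "l = (sqrt l)\<^sup>2" using l by simp
    also have "\<dots> \<le> B\<^sup>2" using l by (intro power_mono) (auto simp: B_def)
    finally show "l \<le> B\<^sup>2" .
  qed (simp add: B_def)
  have Q: "Q \<ge> 0" using assms by (simp add: Q_def)
  have C: "C \<ge> 0" using Q by (simp add: C_def)
  show ?thesis
  proof (rule exI[of _ C], rule exI[of _ "C * (b - a)\<^sup>2"], rule exI[of _ C'], rule exI[of _ 2],
      intro allI impI)
    fix n :: nat assume n2: "n \<ge> 2"
    interpret torus d n a b p
      using assms n2 finite_torus_edges by unfold_locales auto
    define T where "T = torus_time d n"
    define \<Sigma> where "\<Sigma> = (\<Sum>M | M \<subseteq> torus_edges d n \<and> card M = 2. E (\<lambda>w. (partial_set a b M T w)\<^sup>2))"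
    have \<Sigma>: "(\<Sum>M | M \<subseteq> torus_edges d n \<and> card M = 2. (l2_norm (torus_pmf d n a b p) (partial_set a b M T))\<^sup>2) = \<Sigma>"
      unfolding \<Sigma>_def by (intro sum.cong refl) (simp add: l2_norm_def torus_pmf_law E_nonneg)
    have \<Sigma>0: "\<Sigma> \<ge> 0" unfolding \<Sigma>_def by (intro sum_nonneg E_nonneg) simp
    obtain k where k: "2 / (real k + 1)\<^sup>2 + sqrt (Q / real n) * B ^ k \<le>
        (32 * (ln B)\<^sup>2 + 64 * sqrt Q) / (ln (real n))\<^sup>2"
      using ex_level_cutoff[OF B(1) Q n2] by blast
    have "(\<Sum>S | S \<subseteq> torus_edges d n \<and> 2 \<le> card S. (coeff T S)\<^sup>2) \<le>
        (p * (1 - p))\<^sup>2 * (2 / (real k + 1)\<^sup>2 + sqrt (Q / real n) * B ^ k) * \<Sigma>"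
      unfolding \<Sigma>_def
      by (rule second_order_weight)
        (use B prob_partial_pair_torus_le[OF assms(1)] in \<open>simp_all add: l_def T_def Q_def\<close>)
    also have "\<dots> \<le> (p * (1 - p))\<^sup>2 * ((32 * (ln B)\<^sup>2 + 64 * sqrt Q) / (ln (real n))\<^sup>2) * \<Sigma>"
      using k \<Sigma>0 by (intro mult_right_mono mult_left_mono) auto
    also have "\<dots> = C * (\<Sigma> / (ln (real n))\<^sup>2)" by (simp add: C_def)
    finally have high: "(\<Sum>S | S \<subseteq> torus_edges d n \<and> 2 \<le> card S. (coeff T S)\<^sup>2) \<le>
        C * (\<Sigma> / (ln (real n))\<^sup>2)" .
    have one: "p * (1 - p) * (\<Sum>i\<in>torus_edges d n. (E (partial a b i T))\<^sup>2) \<le> C'"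
      unfolding C'_def T_def using level_one_le[OF assms(1)] p by (intro mult_left_mono) auto
    have var: "measure_pmf.variance law T \<le> C * (\<Sigma> / (ln (real n))\<^sup>2) + C'"
      unfolding variance_level_split using high one by linarith
    have "\<Sigma> / (ln (real n))\<^sup>2 \<le>
        ((b - a)\<^sup>2 * E (\<lambda>w. real (num_convoluted d n a b w))) / (ln (real n))\<^sup>2"
      using sum_pair_norms_le by (intro divide_right_mono) (simp_all add: \<Sigma>_def T_def)
    hence "C * (\<Sigma> / (ln (real n))\<^sup>2) \<le>
        C * (((b - a)\<^sup>2 * E (\<lambda>w. real (num_convoluted d n a b w))) / (ln (real n))\<^sup>2)"
      using C by (rule mult_left_mono)
    hence conv: "C * (\<Sigma> / (ln (real n))\<^sup>2) + C' \<le>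
        C * (b - a)\<^sup>2 * (E (\<lambda>w. real (num_convoluted d n a b w)) / (ln (real n))\<^sup>2) + C'"
      by (simp add: mult.assoc)
    show "measure_pmf.variance (torus_pmf d n a b p) (torus_time d n)
      \<le> C * ((\<Sum>M | M \<subseteq> torus_edges d n \<and> card M = 2.
                 (l2_norm (torus_pmf d n a b p) (partial_set a b M (torus_time d n)))\<^sup>2)
             / (ln (real n))\<^sup>2) + C' \<and>
    C * ((\<Sum>M | M \<subseteq> torus_edges d n \<and> card M = 2.
                 (l2_norm (torus_pmf d n a b p) (partial_set a b M (torus_time d n)))\<^sup>2)
             / (ln (real n))\<^sup>2) + C'
      \<le> C * (b - a)\<^sup>2 * (measure_pmf.expectation (torus_pmf d n a b p)
                   (\<lambda>\<omega>. real (num_convoluted d n a b \<omega>))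
                / (ln (real n))\<^sup>2) + C'"
      using var conv \<Sigma> unfolding T_def torus_pmf_law by simp
  qed
qed

end
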